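(* Let $C=C_{\{\mathcal{I}_n,\mathcal{J}_n\}}$ be a nice Cantor set arising from a Cantor construction $\{\mathcal{I}_n,\mathcal{J}_n\}_n$. Then for each $0<p<\infty$ there exist a doubling measure $\mu$ on $\mathbb{R}$ and constants $0<\lambda\le\Lambda<\infty$ such that \[\lambda\left(\frac{|J_{n,i}|}{|I_{n,i}|}\right)^p\le\frac{\mu(J_{n,i})}{\mu(I_{n,i})}\le\Lambda\left(\frac{|J_{n,i}|}{|I_{n,i}|}\right)^p\] for every $n$ and every $I_{n,i}\in\mathcal{I}_n$.
   Context: A measure means a Borel regular outer measure. A measure $\mu$ on a metric space $X$ is doubling if there is $c<\infty$ with $0<\mu(B(x,2r))\le c\,\mu(B(x,r))<\infty$ for all $x\in X$, $r>0$ ($B(x,r)$ the open ball). A Cantor construction $\{\mathcal{I}_n,\mathcal{J}_n\}_n$: for each $n\in\mathbb{N}$, $\mathcal{I}_n=\{I_{n,i}\}_i$ is a collection of closed intervals with mutually disjoint interiors and $\mathcal{J}_n=\{J_{n,i}\}_i$ is a collection of open intervals with $J_{n,i}\subset I_{n,i}$, such that each $I_{n+1,i}$ is contained in some $I_{n,j}$, $\bigcup\mathcal{I}_{n+1}=\bigcup\mathcal{I}_n\setminus\bigcup\mathcal{J}_n$, $\sup_j|I_{n,j}|\to0$ as $n\to\infty$, and $\bigcup\mathcal{I}_1$ is bounded. The Cantor set is $C=\bigcap_n\bigcup_i I_{n,i}$. The construction (and set) is nice if there is $0<c<1$ with $cI_{n,i}\cap J_{n,i}\neq\emptyset$ for all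 $n,i$, where $cI$ denotes the closed interval concentric with $I$ of length $c|I|$. *)

theory Defs
  imports "HOL-Analysis.Analysis"
begin

text \<open>A Cantor construction. Level n consists of the closed intervals
  I n i = {a n i .. b n i} and the open intervals J n i = {c n i <..< d n i},
  for indices i in the index set Idx n. Levels are numbered from 0.\<close>

definition cantor_construction ::
  "(nat \<Rightarrow> nat set) \<Rightarrow> (nat \<Rightarrow> nat \<Rightarrow> real) \<Rightarrow> (nat \<Rightarrow> nat \<Rightarrow> real)
   \<Rightarrow> (nat \<Rightarrow> nat \<Rightarrow> real) \<Rightarrow> (nat \<Rightarrow> nat \<Rightarrow> real) \<Rightarrow> bool" where
  "cantor_construction Idx a b c d \<longleftrightarrow>
     (\<forall>n. \<forall>i\<in>Idx n. a n i \<le> b n i) \<and>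
     (\<forall>n. \<forall>i\<in>Idx n. \<forall>j\<in>Idx n. i \<noteq> j \<longrightarrow>
          {a n i<..<b n i} \<inter> {a n j<..<b n j} = {}) \<and>
     (\<forall>n. \<forall>i\<in>Idx n. {c n i<..<d n i} \<subseteq> {a n i..b n i}) \<and>
     (\<forall>n. \<forall>i\<in>Idx (Suc n). \<exists>j\<in>Idx n. {a (Suc n) i..b (Suc n) i} \<subseteq> {a n j..b n j}) \<and>
     (\<forall>n. (\<Union>i\<in>Idx (Suc n). {a (Suc n) i..b (Suc n) i}) =
          (\<Union>i\<in>Idx n. {a n i..b n i}) - (\<Union>i\<in>Idx n. {c n i<..<d n i})) \<and>
     (\<forall>\<epsilon>>0. \<exists>N. \<forall>n\<ge>N. \<forall>j\<in>Idx n. b n j - a n j < \<epsilon>) \<and>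
     bounded (\<Union>i\<in>Idx 0. {a 0 i..b 0 i})"

definition nice_construction ::
  "(nat \<Rightarrow> nat set) \<Rightarrow> (nat \<Rightarrow> nat \<Rightarrow> real) \<Rightarrow> (nat \<Rightarrow> nat \<Rightarrow> real)
   \<Rightarrow> (nat \<Rightarrow> nat \<Rightarrow> real) \<Rightarrow> (nat \<Rightarrow> nat \<Rightarrow> real) \<Rightarrow> bool" where
  "nice_construction Idx a b c d \<longleftrightarrow>
     cantor_construction Idx a b c d \<and>
     (\<exists>k. 0 < k \<and> k < 1 \<and>
        (\<forall>n. \<forall>i\<in>Idx n.
           {(a n i + b n i) / 2 - k * (b n i - a n i) / 2 ..
            (a n i + b n i) / 2 + k * (b n i - a n i) / 2} \<inter> {c n i<..<d n i} \<noteq> {}))"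

definition doubling_measure :: "'a::metric_space measure \<Rightarrow> bool" where
  "doubling_measure M \<longleftrightarrow>
     sets M = sets borel \<and>
     (\<exists>C::real. (\<forall>x r. r > 0 \<longrightarrow>
        0 < emeasure M (ball x (2 * r)) \<and>
        emeasure M (ball x (2 * r)) \<le> ennreal C * emeasure M (ball x r) \<and>
        emeasure M (ball x r) < \<infinity>))"

end

theory Submission
  imports Defs
begin

text \<open>
  Fix a point \<open>m\<close> of each gap \<open>J\<close> deep inside its interval \<open>I\<close>. Attach to \<open>I\<close> a weight \<open>h\<^sub>I\<close> which near
  \<open>m\<close> is a multiple of \<open>(\<bar>y - m\<bar> / \<bar>I\<bar>) powr (p - 1)\<close>, equals \<open>1\<close> outside a neighbourhood of \<open>m\<close> that
  stays away from the end points of \<open>I\<close>, and is normalised so that multiplying by \<open>h\<^sub>I\<close> does not change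
  the mass that the weights of the larger intervals give to \<open>I\<close>. The measure is
  the infinite product of these weights.

  As \<open>m\<close> is not contained in the smaller intervals, the points \<open>m\<close> belonging to intervals of length at
  least \<open>r\<close> are separated by a multiple of \<open>r\<close>. Hence, on a ball of radius \<open>r\<close>, only boundedly many of
  the weights of intervals longer than \<open>r\<close> have their singularity nearby, and the others
  form a nested family whose logarithmic oscillations have a bounded sum. The remaining weights, of short
  intervals, only move mass over short distances. This gives the doubling property,
  and on \<open>J\<close> the weight of \<open>I\<close> dominates, which gives the exponent \<open>p\<close>.
\<close>

subsection \<open>Elementary estimates\<close>

text \<open>The limit need not have a density, so every estimate concerns finite products. They are
  truncated by length and not by level, since one level may contain intervals of very different
  lengths. Deep gaps make this work: a smaller interval lies on one side of \<open>m\<close>, so it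
  misses a fixed proportion of the larger one. The obstacle is that a gap may be tiny compared with
  its interval. A smaller interval can then come very close, relative to its own length, to the
  singularity of a larger one. Hence the weights of the larger intervals are controlled only on a
  core around the centre of the smaller one, and this is why the mass is restored there and not by a
  correction spread over the whole interval. The exponent arises because a density
  \<open>\<bar>y - m\<bar> powr (p - 1)\<close> gives mass of order \<open>s powr p\<close> to an
  interval of length \<open>s\<close> that contains \<open>m\<close>, wherever \<open>m\<close> lies
  in it.\<close>

lemma sum_inverse_distances_le:
  fixes d l :: "'a \<Rightarrow> real"
  assumes "finite A" "0 < g"
    and "\<And>x. x \<in> A \<Longrightarrow> 0 < l x"
    and "\<And>x y. x \<in> A \<Longrightarrow> y \<in> A \<Longrightarrow> x \<noteq> y \<Longrightarrow> g * min (l x) (l y) \<le> d x + d y"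
    and "0 < e" "\<And>x. x \<in> A \<Longrightarrow> e \<le> d x"
  shows "(\<Sum>x\<in>A. 1 / d x) \<le> 1 / e + (\<Sum>x\<in>A. 2 / (g * l x))"
  using assms(1,3-)
proof (induction A arbitrary: e rule: finite_ranking_induct[where f = "\<lambda>x. - l x"])
  case empty
  then show ?case by simp
next
  case (insert x S)
  note 2 = this
  show ?case
  proof (cases "x \<in> S")
    case True
    then have "insert x S = S" by blast
    then show ?thesis using 2 by metis
  next
    case x: False
    have l: "0 < l y" if "y \<in> insert x S" for y using 2 that by blast
    \<comment> \<open>The induction adds an \<open>x\<close> with smallest \<open>l x\<close>. If
      \<open>d x\<close> is at least \<open>g * l x / 2\<close>, its term is charged to
      \<open>2 / (g * l x)\<close>. Otherwise separation gives \<open>d y\<close> \<ge>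
      \<open>g * l x / 2\<close> for all other \<open>y\<close>: the free term \<open>1 / e\<close>
      pays for \<open>x\<close>, and the induction hypothesis restarts with
      \<open>e = g * l x / 2\<close>, whose reciprocal is the charge of \<open>x\<close>.\<close>
    show ?thesis
    proof (cases "g * l x / 2 \<le> d x")
      case True
      have "1 / d x \<le> 1 / (g * l x / 2)"
        using True l[of x] \<open>0 < g\<close> 2(6) 2(7)[of x]
        by (intro divide_left_mono mult_pos_pos) auto
      moreover have "(\<Sum>x\<in>S. 1 / d x) \<le> 1 / e + (\<Sum>x\<in>S. 2 / (g * l x))"
        using 2 by (intro 2(3)) auto
      ultimately show ?thesis using x 2(1) by (simp add: mult.commute)
    next
      case False
      let ?e = "g * l x / 2"
      have "(\<Sum>x\<in>S. 1 / d x) \<le> 1 / ?e + (\<Sum>x\<in>S. 2 / (g * l x))"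
      proof (rule 2(3))
        fix y assume y: "y \<in> S"
        then have "g * min (l x) (l y) \<le> d x + d y" using 2(5)[of x y] x by auto
        moreover have "min (l x) (l y) = l x" using 2(2)[OF y] by simp
        ultimately show "?e \<le> d y" using False by simp
      qed (use 2 l \<open>0 < g\<close> in auto)
      moreover have "1 / d x \<le> 1 / e"
        using 2(6) 2(7)[of x] by (intro divide_left_mono mult_pos_pos) auto
      ultimately show ?thesis using x 2(1) by simp
    qed
  qed
qed

text \<open>Elements are added in order of decreasing \<open>l\<close>; those before
  \<open>x\<close> are at least \<open>l x / (1 - g)\<close>, and
  \<open>1 + (1 - g) / g = 1 / g\<close> closes the induction as for a geometric series.\<close>

lemma sum_inverse_geometric_le:
  fixes l :: "'a \<Rightarrow> real"
  assumes "finite A" "0 < g" "g < 1"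
    and "\<And>x y. x \<in> A \<Longrightarrow> y \<in> A \<Longrightarrow> x \<noteq> y \<Longrightarrow> l x \<le> (1 - g) * l y \<or> l y \<le> (1 - g) * l x"
    and "0 < e" "\<And>x. x \<in> A \<Longrightarrow> e \<le> l x"
  shows "(\<Sum>x\<in>A. 1 / l x) \<le> 1 / (g * e)"
  using assms(1,4-)
proof (induction A arbitrary: e rule: finite_ranking_induct[where f = "\<lambda>x. - l x"])
  case empty
  then show ?case using \<open>0 < g\<close> by simp
next
  case (insert x S)
  note 2 = this
  show ?case
  proof (cases "x \<in> S")
    case True
    then have "insert x S = S" by blast
    then show ?thesis using 2 by metis
  next
    case x: False
    have lx: "0 < l x" "e \<le> l x" using 2(5) 2(6)[of x] by auto
    have "(\<Sum>x\<in>S. 1 / l x) \<le> 1 / (g * (l x / (1 - g)))"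
    proof (rule 2(3))
      fix y assume y: "y \<in> S"
      have "l x \<le> l y" using 2(2)[OF y] by simp
      then have "l y > (1 - g) * l x" using lx \<open>0 < g\<close>
        by (smt (verit) mult_less_cancel_right2)
      then have "l x \<le> (1 - g) * l y" using 2(4)[of x y] x y by auto
      then show "l x / (1 - g) \<le> l y" using \<open>g < 1\<close> by (simp add: divide_le_eq mult.commute)
    qed (use 2(4) lx \<open>g < 1\<close> in auto)
    then have "(\<Sum>x\<in>insert x S. 1 / l x) \<le> 1 / l x + (1 - g) / (g * l x)"
      using x 2(1) by simp
    also have "\<dots> = 1 / (g * l x)" using lx \<open>0 < g\<close> by (simp add: field_simps)
    also have "\<dots> \<le> 1 / (g * e)"
      using lx \<open>0 < g\<close> \<open>0 < e\<close> by (intro divide_left_mono mult_left_mono mult_pos_pos) auto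
    finally show ?thesis .
  qed
qed

lemma abs_ln_diff_le:
  fixes x y e :: real
  assumes "0 < e" "e \<le> x" "e \<le> y"
  shows "\<bar>ln x - ln y\<bar> \<le> \<bar>x - y\<bar> / e"
proof -
  have *: "ln u - ln v \<le> \<bar>u - v\<bar> / e" if "e \<le> u" "e \<le> v" for u v
  proof -
    have "ln u - ln v \<le> (u - v) / v" using that assms by (intro ln_diff_le) auto
    also have "\<dots> \<le> \<bar>u - v\<bar> / v" using that assms by (intro divide_right_mono) auto
    also have "\<dots> \<le> \<bar>u - v\<bar> / e" using that assms by (intro divide_left_mono mult_pos_pos) auto
    finally show ?thesis .
  qed
  show ?thesis using *[of x y] *[of y x] assms by (auto simp: abs_le_iff abs_minus_commute)
qed

text \<open>Pigeonhole principle: each half-open cell of length \<open>s\<close> contains at most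
  one value of \<open>f\<close>.\<close>

lemma card_separated_le:
  fixes f :: "'b \<Rightarrow> real"
  assumes "finite S" "0 < s" "\<And>x y. x \<in> S \<Longrightarrow> y \<in> S \<Longrightarrow> x \<noteq> y \<Longrightarrow> s \<le> \<bar>f x - f y\<bar>"
    and "\<And>x. x \<in> S \<Longrightarrow> \<bar>f x - c\<bar> \<le> r" "0 \<le> r"
  shows "real (card S) \<le> 2 * r / s + 2"
proof -
  let ?k = "\<lambda>x. \<lfloor>(f x - c + r) / s\<rfloor>"
  have "inj_on ?k S"
  proof (rule inj_onI, rule ccontr)
    fix x y assume xy: "x \<in> S" "y \<in> S" "?k x = ?k y" "x \<noteq> y"
    then have "\<bar>(f x - c + r) / s - (f y - c + r) / s\<bar> < 1" by linarith
    moreover have "(f x - c + r) / s - (f y - c + r) / s = (f x - f y) / s"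
      by (simp add: diff_divide_distrib add_divide_distrib)
    ultimately have "\<bar>f x - f y\<bar> < s" using \<open>0 < s\<close> by (simp add: abs_divide)
    then show False using assms(3)[OF xy(1,2,4)] by simp
  qed
  moreover have "?k ` S \<subseteq> {0..\<lfloor>2 * r / s\<rfloor>}"
  proof
    fix k assume "k \<in> ?k ` S"
    then obtain x where x: "x \<in> S" "k = ?k x" by blast
    then have "0 \<le> f x - c + r" "f x - c + r \<le> 2 * r" using assms(4)[of x] by auto
    then show "k \<in> {0..\<lfloor>2 * r / s\<rfloor>}"
      using \<open>0 < s\<close> x by (auto intro!: floor_mono divide_right_mono)
  qed
  ultimately have "card S \<le> card {0..\<lfloor>2 * r / s\<rfloor>}"
    by (metis card_inj_on_le finite_atLeastAtMost_int)
  then have "real (card S) \<le> real (nat (\<lfloor>2 * r / s\<rfloor> + 1))" by simp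
  also have "\<dots> = \<lfloor>2 * r / s\<rfloor> + 1" using assms by (simp add: of_nat_nat)
  also have "\<dots> \<le> 2 * r / s + 2" by linarith
  finally show ?thesis .
qed

subsection \<open>Trees of intervals and their weights\<close>

text \<open>An element of \<open>At\<close> stands for a pair \<open>(n, i)\<close> and \<open>m \<alpha>\<close> for a point of the gap
  \<open>J\<^bsub>n,i\<^esub>\<close> deep inside \<open>I\<^bsub>n,i\<^esub>\<close>. Levels are forgotten: only nestedness matters.\<close>

locale interval_tree =
  fixes At :: "'a set" and lo hi m :: "'a \<Rightarrow> real" and g R p :: real
  assumes g: "0 < g" "g < 1 / 2" and p: "0 < p"
    and lo_less_hi: "\<alpha> \<in> At \<Longrightarrow> lo \<alpha> < hi \<alpha>"
    and m_lower: "\<alpha> \<in> At \<Longrightarrow> lo \<alpha> + g * (hi \<alpha> - lo \<alpha>) \<le> m \<alpha>"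
    and m_upper: "\<alpha> \<in> At \<Longrightarrow> m \<alpha> \<le> hi \<alpha> - g * (hi \<alpha> - lo \<alpha>)"
    and tree: "\<alpha> \<in> At \<Longrightarrow> \<beta> \<in> At \<Longrightarrow> \<alpha> \<noteq> \<beta> \<Longrightarrow>
      {lo \<alpha><..<hi \<alpha>} \<inter> {lo \<beta><..<hi \<beta>} = {} \<or>
      {lo \<alpha>..hi \<alpha>} \<subseteq> {lo \<beta>..hi \<beta>} \<and> m \<beta> \<notin> {lo \<alpha>..hi \<alpha>} \<or>
      {lo \<beta>..hi \<beta>} \<subseteq> {lo \<alpha>..hi \<alpha>} \<and> m \<alpha> \<notin> {lo \<beta>..hi \<beta>}"
    and bounded_At: "\<alpha> \<in> At \<Longrightarrow> - R \<le> lo \<alpha> \<and> hi \<alpha> \<le> R"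
begin

definition L :: "'a \<Rightarrow> real" where "L \<alpha> = hi \<alpha> - lo \<alpha>"

definition below :: "'a \<Rightarrow> 'a \<Rightarrow> bool" where
  "below \<alpha> \<beta> \<longleftrightarrow> \<alpha> \<noteq> \<beta> \<and> lo \<beta> \<le> lo \<alpha> \<and> hi \<alpha> \<le> hi \<beta>"

definition anc :: "'a \<Rightarrow> 'a set" where "anc \<alpha> = {\<beta>\<in>At. below \<alpha> \<beta>}"

section \<open>Geometry of nested intervals and their centres\<close>

lemma L_pos: "\<alpha> \<in> At \<Longrightarrow> 0 < L \<alpha>"
  using lo_less_hi by (simp add: L_def)

lemma m_ends: "\<alpha> \<in> At \<Longrightarrow> lo \<alpha> + g * L \<alpha> \<le> m \<alpha>" "\<alpha> \<in> At \<Longrightarrow> m \<alpha> + g * L \<alpha> \<le> hi \<alpha>"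
  using m_lower m_upper by (force simp: L_def)+

lemma gL_pos: "\<alpha> \<in> At \<Longrightarrow> 0 < g * L \<alpha>"
  using L_pos g by simp

lemma m_inside: "\<alpha> \<in> At \<Longrightarrow> lo \<alpha> < m \<alpha>" "\<alpha> \<in> At \<Longrightarrow> m \<alpha> < hi \<alpha>"
  using m_ends[of \<alpha>] gL_pos[of \<alpha>] by auto

text \<open>The only competing case of the tree axiom is the reverse inclusion. It would make the
  two intervals equal and place \<open>m \<alpha>\<close> outside its own interval.\<close>

lemma below_m:
  assumes "\<alpha> \<in> At" "\<beta> \<in> At" "below \<alpha> \<beta>"
  shows "m \<beta> < lo \<alpha> \<or> hi \<alpha> < m \<beta>"
proof -
  have "(lo \<alpha> + hi \<alpha>) / 2 \<in> {lo \<alpha><..<hi \<alpha>} \<inter> {lo \<beta><..<hi \<beta>}"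
    using assms lo_less_hi[of \<alpha>] by (auto simp: below_def)
  then consider "m \<beta> \<notin> {lo \<alpha>..hi \<alpha>}"
    | "{lo \<beta>..hi \<beta>} \<subseteq> {lo \<alpha>..hi \<alpha>}" "m \<alpha> \<notin> {lo \<beta>..hi \<beta>}"
    using tree[of \<alpha> \<beta>] assms by (auto simp: below_def)
  then show ?thesis
  proof cases
    case 2
    then have "lo \<alpha> = lo \<beta>" "hi \<alpha> = hi \<beta>"
      using assms lo_less_hi[of \<beta>] by (auto simp: below_def)
    then show ?thesis using 2 m_inside[of \<alpha>] assms by auto
  qed auto
qed

lemma below_m_dist:
  assumes "\<alpha> \<in> At" "\<beta> \<in> At" "below \<alpha> \<beta>"
  shows "g * L \<alpha> \<le> \<bar>m \<beta> - m \<alpha>\<bar>"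
  using below_m[OF assms] m_ends[of \<alpha>] assms by auto

text \<open>The smaller interval lies on one side of \<open>m \<beta>\<close>, hence misses a piece
  of length at least \<open>g * L \<beta>\<close> at the other end. This is the source of all
  geometric decay.\<close>

lemma below_L:
  assumes "\<alpha> \<in> At" "\<beta> \<in> At" "below \<alpha> \<beta>"
  shows "L \<alpha> \<le> (1 - g) * L \<beta>"
  using below_m[OF assms] m_ends[of \<beta>] assms by (auto simp: L_def below_def algebra_simps)

lemma below_L_less:
  assumes "\<alpha> \<in> At" "\<beta> \<in> At" "below \<alpha> \<beta>"
  shows "L \<alpha> < L \<beta>"
  using below_L[OF assms] gL_pos[of \<beta>] assms by (simp add: algebra_simps)

lemma overlap_nested:
  assumes "\<alpha> \<in> At" "\<beta> \<in> At" "\<alpha> \<noteq> \<beta>" "lo \<alpha> < hi \<beta>" "lo \<beta> < hi \<alpha>"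
  shows "below \<alpha> \<beta> \<or> below \<beta> \<alpha>"
proof -
  have "(max (lo \<alpha>) (lo \<beta>) + min (hi \<alpha>) (hi \<beta>)) / 2 \<in> {lo \<alpha><..<hi \<alpha>} \<inter> {lo \<beta><..<hi \<beta>}"
    using assms lo_less_hi[of \<alpha>] lo_less_hi[of \<beta>] by (auto simp: min_def max_def)
  then have "{lo \<alpha>..hi \<alpha>} \<subseteq> {lo \<beta>..hi \<beta>} \<or> {lo \<beta>..hi \<beta>} \<subseteq> {lo \<alpha>..hi \<alpha>}"
    using tree[of \<alpha> \<beta>] assms by blast
  then show ?thesis
    using assms lo_less_hi[of \<alpha>] lo_less_hi[of \<beta>] by (auto simp: below_def)
qed

text \<open>Each centre is \<open>g * L\<close> deep in its own interval. This settles the case of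
  disjoint interiors; for nested intervals, the centre of the larger one lies outside the smaller
  one.\<close>

lemma m_separated:
  assumes "\<alpha> \<in> At" "\<beta> \<in> At" "\<alpha> \<noteq> \<beta>"
  shows "g * min (L \<alpha>) (L \<beta>) \<le> \<bar>m \<alpha> - m \<beta>\<bar>"
proof -
  have min: "g * min (L \<alpha>) (L \<beta>) \<le> g * L \<alpha>" "g * min (L \<alpha>) (L \<beta>) \<le> g * L \<beta>"
    using g by (auto intro!: mult_left_mono)
  consider "below \<alpha> \<beta>" | "below \<beta> \<alpha>" | "hi \<beta> \<le> lo \<alpha> \<or> hi \<alpha> \<le> lo \<beta>"
    using overlap_nested[OF assms] by fastforce
  then show ?thesis
  proof cases
    case 3
    then show ?thesis using m_ends[of \<alpha>] m_ends[of \<beta>] assms gL_pos[of \<alpha>] gL_pos[of \<beta>] min by auto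
  qed (use below_m_dist[of \<alpha> \<beta>] below_m_dist[of \<beta> \<alpha>] assms min in auto)
qed

lemma anc_nested:
  assumes "\<alpha> \<in> At" "\<beta> \<in> anc \<alpha>" "\<gamma> \<in> anc \<alpha>" "\<beta> \<noteq> \<gamma>"
  shows "below \<beta> \<gamma> \<or> below \<gamma> \<beta>"
  using assms lo_less_hi[of \<alpha>] by (intro overlap_nested) (auto simp: anc_def below_def)

text \<open>Centres of such intervals are \<open>g * e\<close> apart in a bounded set. This local
  finiteness makes truncation by length, and recursion from larger to smaller intervals,
  possible.\<close>

lemma finite_large:
  assumes "0 < e"
  shows "finite {\<alpha>\<in>At. e \<le> L \<alpha>}"
proof (cases "At = {}")
  case False
  then obtain \<alpha>0 where "\<alpha>0 \<in> At" by blast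
  then have R: "0 \<le> R" using bounded_At[of \<alpha>0] lo_less_hi[of \<alpha>0] by simp
  show ?thesis
  proof (rule conjunct1[OF finite_if_finite_subsets_card_bdd])
    fix G assume G: "G \<subseteq> {\<alpha>\<in>At. e \<le> L \<alpha>}" "finite G"
    have "real (card G) \<le> 2 * R / (g * e) + 2"
    proof (rule card_separated_le[where f = m and c = 0])
      show "g * e \<le> \<bar>m x - m y\<bar>" if "x \<in> G" "y \<in> G" "x \<noteq> y" for x y
      proof -
        have "g * e \<le> g * min (L x) (L y)" using that G g by (auto intro!: mult_left_mono)
        then show ?thesis using m_separated[of x y] that G by (fastforce simp del: mult_le_cancel_left)
      qed
      show "\<bar>m x - 0\<bar> \<le> R" if "x \<in> G" for x
        using bounded_At[of x] m_inside[of x] that G by (auto simp: abs_le_iff dest!: subsetD)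
    qed (use G g assms R in auto)
    then show "card G \<le> nat \<lceil>2 * R / (g * e) + 2\<rceil>" by linarith
  qed
qed simp

lemma finite_anc: "\<alpha> \<in> At \<Longrightarrow> finite (anc \<alpha>)"
  by (rule finite_subset[OF _ finite_large[of "L \<alpha>"]])
    (use below_L_less L_pos in \<open>auto simp: anc_def less_imp_le\<close>)

text \<open>Lipschitz constant of \<open>ln h\<close> in units of the distance to the centre:
  \<open>\<bar>p - 1\<bar>\<close> comes from \<open>phi\<close> and \<open>1\<close> from the
  bump.\<close>

definition Lam :: real where "Lam = \<bar>p - 1\<bar> + 1"

definition K :: real where "K = Lam * (2 + 4 / g)"

text \<open>Solves an equation: the bound \<open>2 * eta * L * (1 + 1 / p) * exp K\<close> for the
  mass changed by \<open>phi\<close> has to be half the lower bound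
  \<open>g * L / 16 * exp (- K)\<close> for the mass of the bump, both relative to the surrounding
  density.\<close>

definition eta :: real where "eta = g / (64 * exp (2 * K) * (1 + 1 / p))"

text \<open>The factor \<open>phi\<close> gives the gap the right mass; \<open>psi\<close> is a wide bump that restores the total
  mass. The oscillation bound \<open>K\<close> does not involve \<open>eta\<close>, so \<open>eta\<close> can be chosen so small that
  a coefficient \<open>\<bar>t\<bar> \<le> 1 / 2\<close> of the bump suffices.\<close>

definition phi :: "'a \<Rightarrow> real \<Rightarrow> real" where
  "phi \<alpha> y = min 1 (\<bar>y - m \<alpha>\<bar> / (eta * L \<alpha>)) powr (p - 1)"

definition psi :: "'a \<Rightarrow> real \<Rightarrow> real" where
  "psi \<alpha> y = max 0 (1 - 2 * \<bar>y - m \<alpha>\<bar> / (g * L \<alpha>))"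

definition h :: "'a \<Rightarrow> real \<Rightarrow> real \<Rightarrow> real" where
  "h \<alpha> t y = phi \<alpha> y * (1 + t * psi \<alpha> y)"

definition W :: "('a \<Rightarrow> real) \<Rightarrow> 'a set \<Rightarrow> real \<Rightarrow> real" where
  "W t A y = (\<Prod>\<alpha>\<in>A. h \<alpha> (t \<alpha>) y)"

definition N :: "('a \<Rightarrow> real) \<Rightarrow> 'a set \<Rightarrow> real measure" where
  "N t A = density lborel (\<lambda>y. ennreal (W t A y))"

section \<open>Pointwise bounds for a single weight\<close>

lemma Lam_pos: "0 < Lam" by (simp add: Lam_def)

lemma K_pos: "0 < K" using Lam_pos g by (simp add: K_def add_pos_pos)

lemma eta_pos: "0 < eta"
  using g p by (simp add: eta_def add_pos_pos)

lemma eta_le: "eta \<le> g / 64"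
proof -
  have "1 * 1 \<le> exp (2 * K) * (1 + 1 / p)" using K_pos p by (intro mult_mono) auto
  then have "g / (64 * exp (2 * K) * (1 + 1 / p)) \<le> g / 64"
    using g p by (intro divide_left_mono) (auto simp: add_pos_pos mult.assoc)
  then show ?thesis by (simp add: eta_def)
qed

lemma psi_bounds: "0 \<le> psi \<alpha> y" "\<alpha> \<in> At \<Longrightarrow> psi \<alpha> y \<le> 1"
  using gL_pos[of \<alpha>] by (auto simp: psi_def)

lemma psi_eq_0: "\<alpha> \<in> At \<Longrightarrow> g * L \<alpha> / 2 \<le> \<bar>y - m \<alpha>\<bar> \<Longrightarrow> psi \<alpha> y = 0"
  using gL_pos[of \<alpha>] by (auto simp: psi_def field_simps)

lemma phi_eq_1: "\<alpha> \<in> At \<Longrightarrow> eta * L \<alpha> \<le> \<bar>y - m \<alpha>\<bar> \<Longrightarrow> phi \<alpha> y = 1"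
  using L_pos[of \<alpha>] eta_pos by (auto simp: phi_def field_simps)

lemma phi_nonneg: "0 \<le> phi \<alpha> y" by (simp add: phi_def)

lemma phi_pos: "\<alpha> \<in> At \<Longrightarrow> y \<noteq> m \<alpha> \<Longrightarrow> 0 < phi \<alpha> y"
  using L_pos[of \<alpha>] eta_pos by (auto simp: phi_def min_def)

lemma bump_bounds:
  assumes "\<alpha> \<in> At" "\<bar>t\<bar> \<le> 1 / 2"
  shows "1 / 2 \<le> 1 + t * psi \<alpha> y" "1 + t * psi \<alpha> y \<le> 3 / 2"
proof -
  have "\<bar>t * psi \<alpha> y\<bar> \<le> 1 / 2 * 1" unfolding abs_mult
    using assms psi_bounds[of \<alpha> y] by (intro mult_mono) auto
  then show "1 / 2 \<le> 1 + t * psi \<alpha> y" "1 + t * psi \<alpha> y \<le> 3 / 2" by auto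
qed

lemma h_nonneg: "\<alpha> \<in> At \<Longrightarrow> \<bar>t\<bar> \<le> 1 / 2 \<Longrightarrow> 0 \<le> h \<alpha> t y"
  using bump_bounds[of \<alpha> t y] phi_nonneg[of \<alpha> y] by (simp add: h_def)

lemma h_pos: "\<alpha> \<in> At \<Longrightarrow> \<bar>t\<bar> \<le> 1 / 2 \<Longrightarrow> y \<noteq> m \<alpha> \<Longrightarrow> 0 < h \<alpha> t y"
  using bump_bounds[of \<alpha> t y] phi_pos[of \<alpha> y] by (simp add: h_def)

lemma eta_le_half: "\<alpha> \<in> At \<Longrightarrow> eta * L \<alpha> \<le> g * L \<alpha> / 2"
  using eta_le L_pos[of \<alpha>] g mult_right_mono[of eta "g / 2" "L \<alpha>"] by auto

lemma h_eq_1: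
  assumes "\<alpha> \<in> At" "g * L \<alpha> / 2 \<le> \<bar>y - m \<alpha>\<bar>"
  shows "h \<alpha> t y = 1"
  using psi_eq_0[OF assms] phi_eq_1[of \<alpha> y] eta_le_half[of \<alpha>] assms by (simp add: h_def)

text \<open>The cutoff scale \<open>q = eta * L \<alpha>\<close> cancels. If \<open>D\<close> \<le>
  \<open>q\<close>, both truncated ratios are at least \<open>D / q\<close> and differ by at most
  \<open>\<bar>y - z\<bar> / q\<close>; otherwise \<open>phi\<close> is \<open>1\<close> at both
  points. Hence the bound is free of \<open>eta\<close>.\<close>

lemma ln_phi_lipschitz:
  assumes "\<alpha> \<in> At" "0 < D" "D \<le> \<bar>y - m \<alpha>\<bar>" "D \<le> \<bar>z - m \<alpha>\<bar>"
  shows "\<bar>ln (phi \<alpha> y) - ln (phi \<alpha> z)\<bar> \<le> \<bar>p - 1\<bar> * (\<bar>y - z\<bar> / D)"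
proof -
  define q where "q = eta * L \<alpha>"
  have q: "0 < q" using L_pos eta_pos assms by (simp add: q_def)
  define u v where "u = min 1 (\<bar>y - m \<alpha>\<bar> / q)" and "v = min 1 (\<bar>z - m \<alpha>\<bar> / q)"
  have uv: "0 < u" "0 < v" using assms q by (auto simp: u_def v_def)
  have "\<bar>ln u - ln v\<bar> \<le> \<bar>y - z\<bar> / D"
  proof (cases "D / q \<le> 1")
    case True
    have "\<bar>ln u - ln v\<bar> \<le> \<bar>u - v\<bar> / (D / q)"
      using True assms q by (intro abs_ln_diff_le) (auto simp: u_def v_def divide_right_mono)
    also have "\<bar>u - v\<bar> \<le> \<bar>y - z\<bar> / q"
    proof -
      have "\<bar>u - v\<bar> \<le> \<bar>\<bar>y - m \<alpha>\<bar> / q - \<bar>z - m \<alpha>\<bar> / q\<bar>" unfolding u_def v_def by linarith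
      also have "\<dots> = \<bar>\<bar>y - m \<alpha>\<bar> - \<bar>z - m \<alpha>\<bar>\<bar> / q" using q by (simp add: diff_divide_distrib[symmetric])
      also have "\<dots> \<le> \<bar>y - z\<bar> / q" using q by (intro divide_right_mono) auto
      finally show ?thesis .
    qed
    then have "\<bar>u - v\<bar> / (D / q) \<le> \<bar>y - z\<bar> / q / (D / q)"
      using q assms by (intro divide_right_mono) auto
    also have "\<dots> = \<bar>y - z\<bar> / D" using q assms by (simp add: field_simps)
    finally show ?thesis .
  next
    case False
    then have "1 \<le> \<bar>y - m \<alpha>\<bar> / q" "1 \<le> \<bar>z - m \<alpha>\<bar> / q"
      using assms q by (auto simp: field_simps)
    then have "u = 1" "v = 1" by (auto simp: u_def v_def)
    then show ?thesis using assms by simp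
  qed
  moreover have "ln (phi \<alpha> y) - ln (phi \<alpha> z) = (p - 1) * (ln u - ln v)"
    using uv by (simp add: phi_def u_def[symmetric] v_def[symmetric] q_def[symmetric] ln_powr algebra_simps)
  ultimately show ?thesis by (simp only: abs_mult) (rule mult_left_mono, auto)
qed

text \<open>Either \<open>psi\<close> vanishes at both points, or \<open>D\<close> is below its
  radius \<open>g * L \<alpha> / 2\<close>, whose reciprocal bounds its slope. The factor
  \<open>2\<close> lost in the logarithm is absorbed by
  \<open>\<bar>t\<bar> \<le> 1 / 2\<close>.\<close>

lemma ln_bump_lipschitz:
  assumes "\<alpha> \<in> At" "\<bar>t\<bar> \<le> 1 / 2" "0 < D" "D \<le> \<bar>y - m \<alpha>\<bar>" "D \<le> \<bar>z - m \<alpha>\<bar>"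
  shows "\<bar>ln (1 + t * psi \<alpha> y) - ln (1 + t * psi \<alpha> z)\<bar> \<le> \<bar>y - z\<bar> / D"
proof (cases "g * L \<alpha> / 2 \<le> D")
  case True
  then show ?thesis using assms psi_eq_0[of \<alpha> y] psi_eq_0[of \<alpha> z] by simp
next
  case False
  define q where "q = g * L \<alpha> / 2"
  have q: "0 < q" using gL_pos assms by (simp add: q_def)
  have psi: "psi \<alpha> w = max 0 (1 - \<bar>w - m \<alpha>\<bar> / q)" for w by (simp add: psi_def q_def mult.commute)
  have "\<bar>ln (1 + t * psi \<alpha> y) - ln (1 + t * psi \<alpha> z)\<bar> \<le>
      \<bar>(1 + t * psi \<alpha> y) - (1 + t * psi \<alpha> z)\<bar> / (1 / 2)"
    using bump_bounds assms by (intro abs_ln_diff_le) auto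
  also have "\<dots> = 2 * \<bar>t\<bar> * \<bar>psi \<alpha> y - psi \<alpha> z\<bar>"
    by (simp add: abs_mult[symmetric] algebra_simps)
  also have "\<dots> \<le> 1 * (\<bar>y - z\<bar> / q)"
  proof (rule mult_mono)
    have "\<bar>psi \<alpha> y - psi \<alpha> z\<bar> \<le> \<bar>\<bar>y - m \<alpha>\<bar> / q - \<bar>z - m \<alpha>\<bar> / q\<bar>" unfolding psi by linarith
    also have "\<dots> = \<bar>\<bar>y - m \<alpha>\<bar> - \<bar>z - m \<alpha>\<bar>\<bar> / q" using q by (simp add: diff_divide_distrib[symmetric])
    also have "\<dots> \<le> \<bar>y - z\<bar> / q" using q by (intro divide_right_mono) auto
    finally show "\<bar>psi \<alpha> y - psi \<alpha> z\<bar> \<le> \<bar>y - z\<bar> / q" .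
  qed (use assms in auto)
  also have "\<dots> \<le> \<bar>y - z\<bar> / D"
    unfolding mult_1 using False q assms by (intro divide_left_mono) (auto simp: q_def[symmetric])
  finally show ?thesis .
qed

lemma ln_h_lipschitz:
  assumes "\<alpha> \<in> At" "\<bar>t\<bar> \<le> 1 / 2" "0 < D" "D \<le> \<bar>y - m \<alpha>\<bar>" "D \<le> \<bar>z - m \<alpha>\<bar>"
  shows "\<bar>ln (h \<alpha> t y) - ln (h \<alpha> t z)\<bar> \<le> Lam * (\<bar>y - z\<bar> / D)"
proof -
  have "ln (h \<alpha> t w) = ln (phi \<alpha> w) + ln (1 + t * psi \<alpha> w)" if "D \<le> \<bar>w - m \<alpha>\<bar>" for w
    unfolding h_def using phi_pos[of \<alpha> w] bump_bounds(1)[OF assms(1,2), of w] that assms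
    by (intro ln_mult_pos) auto
  then have "ln (h \<alpha> t y) - ln (h \<alpha> t z) = (ln (phi \<alpha> y) - ln (phi \<alpha> z)) +
      (ln (1 + t * psi \<alpha> y) - ln (1 + t * psi \<alpha> z))" using assms by simp
  then show ?thesis
    using ln_phi_lipschitz[OF assms(1,3-)] ln_bump_lipschitz[OF assms]
    unfolding Lam_def distrib_right by linarith
qed

lemma W_nonneg: "A \<subseteq> At \<Longrightarrow> (\<And>\<alpha>. \<bar>t \<alpha>\<bar> \<le> 1 / 2) \<Longrightarrow> 0 \<le> W t A y"
  using h_nonneg by (auto simp: W_def intro!: prod_nonneg)

lemma W_pos: "A \<subseteq> At \<Longrightarrow> (\<And>\<alpha>. \<alpha> \<in> A \<Longrightarrow> \<bar>t \<alpha>\<bar> \<le> 1 / 2) \<Longrightarrow> y \<notin> m ` A \<Longrightarrow> 0 < W t A y"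
  unfolding W_def by (intro prod_pos h_pos) auto

text \<open>The centres of a nested family accumulate geometrically, so far from the centres
  all logarithmic oscillations together stay bounded.\<close>

lemma W_oscillation:
  assumes A: "finite A" "A \<subseteq> At" and t: "\<And>\<alpha>. \<alpha> \<in> A \<Longrightarrow> \<bar>t \<alpha>\<bar> \<le> 1 / 2" and "0 < r"
    and nested: "\<And>\<alpha> \<beta>. \<alpha> \<in> A \<Longrightarrow> \<beta> \<in> A \<Longrightarrow> \<alpha> \<noteq> \<beta> \<Longrightarrow> below \<alpha> \<beta> \<or> below \<beta> \<alpha>"
    and far: "\<And>\<alpha>. \<alpha> \<in> A \<Longrightarrow> 2 * r \<le> \<bar>m \<alpha> - x\<bar>"
    and large: "\<And>\<alpha>. \<alpha> \<in> A \<Longrightarrow> 2 * r / g \<le> L \<alpha>"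
    and y: "\<bar>y - x\<bar> \<le> r" and z: "\<bar>z - x\<bar> \<le> r"
  shows "W t A y \<le> exp K * W t A z"
proof -
  let ?d = "\<lambda>\<alpha>. \<bar>m \<alpha> - x\<bar>"
  have dist: "?d \<alpha> / 2 \<le> \<bar>w - m \<alpha>\<bar>" if "\<alpha> \<in> A" "\<bar>w - x\<bar> \<le> r" for \<alpha> w
  proof -
    have "\<bar>m \<alpha> - x\<bar> \<le> \<bar>w - m \<alpha>\<bar> + \<bar>w - x\<bar>" by linarith
    then show ?thesis using far[OF that(1)] that(2) by argo
  qed
  have notin: "w \<notin> m ` A" if "\<bar>w - x\<bar> \<le> r" for w
    using far \<open>0 < r\<close> that by fastforce
  have pos: "0 < W t A y" "0 < W t A z"
    using W_pos[OF A(2) t] notin y z by auto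
  have lnW: "ln (W t A w) = (\<Sum>\<alpha>\<in>A. ln (h \<alpha> (t \<alpha>) w))" if "\<bar>w - x\<bar> \<le> r" for w
    unfolding W_def
  proof (rule ln_prod)
    fix \<alpha> assume "\<alpha> \<in> A"
    then have "0 < h \<alpha> (t \<alpha>) w" using A t notin[OF that] by (intro h_pos) auto
    then show "h \<alpha> (t \<alpha>) w \<noteq> 0" by simp
  qed (use A in auto)
  \<comment> \<open>Nested lengths shrink by the factor \<open>1 - g\<close> and stay above
    \<open>2 * r / g\<close>, so their reciprocals sum to at most
    \<open>1 / (2 * r)\<close>.\<close>
  have "(\<Sum>\<alpha>\<in>A. 1 / L \<alpha>) \<le> 1 / (g * (2 * r / g))"
  proof (rule sum_inverse_geometric_le)
    show "L \<alpha> \<le> (1 - g) * L \<beta> \<or> L \<beta> \<le> (1 - g) * L \<alpha>" if "\<alpha> \<in> A" "\<beta> \<in> A" "\<alpha> \<noteq> \<beta>" for \<alpha> \<beta>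
      using nested[OF that] below_L A that by (meson subsetD)
  qed (use g A large \<open>0 < r\<close> in auto)
  then have "2 / g * (\<Sum>\<alpha>\<in>A. 1 / L \<alpha>) \<le> 2 / g * (1 / (2 * r))"
    using g by (intro mult_left_mono) auto
  then have sumL: "(\<Sum>\<alpha>\<in>A. 2 / (g * L \<alpha>)) \<le> 2 / g * (1 / (2 * r))"
    unfolding sum_distrib_left by (simp add: mult.commute)
  \<comment> \<open>A centre may be much closer to \<open>x\<close> than the length of its interval
    suggests. Because the centres are separated, the single extra term \<open>1 / (2 * r)\<close>
    pays for all such cases.\<close>
  have "(\<Sum>\<alpha>\<in>A. 1 / ?d \<alpha>) \<le> 1 / (2 * r) + (\<Sum>\<alpha>\<in>A. 2 / (g * L \<alpha>))"
  proof (rule sum_inverse_distances_le)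
    show "g * min (L \<alpha>) (L \<beta>) \<le> ?d \<alpha> + ?d \<beta>" if "\<alpha> \<in> A" "\<beta> \<in> A" "\<alpha> \<noteq> \<beta>" for \<alpha> \<beta>
    proof -
      have "g * min (L \<alpha>) (L \<beta>) \<le> \<bar>m \<alpha> - m \<beta>\<bar>" using m_separated[of \<alpha> \<beta>] that A by blast
      also have "\<dots> \<le> ?d \<alpha> + ?d \<beta>" by linarith
      finally show ?thesis .
    qed
  qed (use A g L_pos far \<open>0 < r\<close> in auto)
  also have "\<dots> \<le> 1 / (2 * r) + 2 / g * (1 / (2 * r))" using sumL by simp
  finally have sumd: "(\<Sum>\<alpha>\<in>A. 1 / ?d \<alpha>) \<le> 1 / (2 * r) + 2 / g * (1 / (2 * r))" .
  have "ln (W t A y) - ln (W t A z) = (\<Sum>\<alpha>\<in>A. ln (h \<alpha> (t \<alpha>) y) - ln (h \<alpha> (t \<alpha>) z))"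
    by (simp add: lnW y z sum_subtractf)
  also have "\<dots> \<le> (\<Sum>\<alpha>\<in>A. Lam * (4 * r) * (1 / ?d \<alpha>))"
  proof (rule sum_mono)
    fix \<alpha> assume \<alpha>: "\<alpha> \<in> A"
    have d: "0 < ?d \<alpha>" using far[OF \<alpha>] \<open>0 < r\<close> by linarith
    have "\<bar>ln (h \<alpha> (t \<alpha>) y) - ln (h \<alpha> (t \<alpha>) z)\<bar> \<le> Lam * (\<bar>y - z\<bar> / (?d \<alpha> / 2))"
      using \<alpha> A t dist y z d by (intro ln_h_lipschitz) auto
    also have "\<dots> \<le> Lam * (2 * r / (?d \<alpha> / 2))"
      using d Lam_pos y z by (intro mult_left_mono divide_right_mono) auto
    finally show "ln (h \<alpha> (t \<alpha>) y) - ln (h \<alpha> (t \<alpha>) z) \<le> Lam * (4 * r) * (1 / ?d \<alpha>)"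
      by (simp add: mult.assoc)
  qed
  also have "\<dots> \<le> Lam * (4 * r) * (1 / (2 * r) + 2 / g * (1 / (2 * r)))"
    unfolding sum_distrib_left[symmetric] using sumd Lam_pos \<open>0 < r\<close> by (intro mult_left_mono) auto
  \<comment> \<open>With the factor \<open>Lam * (4 * r)\<close> the two terms become
    \<open>2\<close> and \<open>4 / g\<close>, which explains the definition of
    \<open>K\<close>.\<close>
  also have "\<dots> = K" using \<open>0 < r\<close> by (simp add: K_def field_simps)
  finally have "ln (W t A y) \<le> ln (exp K * W t A z)" using pos by (simp add: ln_mult)
  then show ?thesis using pos by (subst (asm) ln_le_cancel_iff) auto
qed

end

subsection \<open>Preserving the mass of every interval\<close>

lemma has_integral_mult_indicator_UNIV:
  fixes f :: "real \<Rightarrow> real"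
  shows "((\<lambda>x. f x * indicator S x) has_integral I) UNIV \<longleftrightarrow> (f has_integral I) S"
proof -
  have "(\<lambda>x. f x * indicator S x) = (\<lambda>x. if x \<in> S then f x else 0)"
    by (auto simp: indicator_def)
  then show ?thesis by (simp add: has_integral_restrict_UNIV)
qed

text \<open>One-sided, with direction \<open>\<sigma>\<close>, because a gap may extend far from its
  centre on one side only; the lower bound for its mass then uses just that side.\<close>

lemma has_bochner_integral_powr_dist:
  fixes p q s c :: real
  assumes "0 < p" "0 < q" "0 \<le> s" "\<sigma> = 1 \<or> \<sigma> = - 1"
  shows "has_bochner_integral lborel
    (\<lambda>y. indicator {y. 0 \<le> \<sigma> * (y - c) \<and> \<sigma> * (y - c) \<le> s} y * (\<bar>y - c\<bar> / q) powr (p - 1))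
    (q * (s / q) powr p / p)"
proof (rule has_bochner_integral_nn_integral)
  let ?f = "\<lambda>y. indicator {y. 0 \<le> \<sigma> * (y - c) \<and> \<sigma> * (y - c) \<le> s} y * (\<bar>y - c\<bar> / q) powr (p - 1)"
  show "?f \<in> borel_measurable lborel" by measurable
  have "((\<lambda>x. x powr (p - 1)) has_integral ((s / q) powr (p - 1 + 1) / (p - 1 + 1))) {0..s / q}"
    using assms by (intro has_integral_powr_from_0) auto
  then have "(\<integral>\<^sup>+x. ennreal (x powr (p - 1) * indicator {0..s / q} x) \<partial>lborel) = ennreal ((s / q) powr p / p)"
    by (intro nn_integral_has_integral_lborel) (auto simp: has_integral_mult_indicator_UNIV)
  moreover have "?f (c + \<sigma> * q * x) = x powr (p - 1) * indicator {0..s / q} x" for x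
  proof -
    have "\<sigma> * (c + \<sigma> * q * x - c) = q * x" using assms(4) by auto
    moreover have "0 \<le> q * x \<and> q * x \<le> s \<longleftrightarrow> 0 \<le> x \<and> x \<le> s / q"
      using assms by (auto simp: field_simps zero_le_mult_iff)
    moreover have "\<bar>c + \<sigma> * q * x - c\<bar> / q = \<bar>x\<bar>" using assms by (auto simp: abs_mult)
    ultimately show ?thesis by (simp only: mem_Collect_eq indicator_def atLeastAtMost_iff) auto
  qed
  moreover have "(\<integral>\<^sup>+y. ennreal (?f y) \<partial>lborel) = \<bar>\<sigma> * q\<bar> * (\<integral>\<^sup>+x. ennreal (?f (c + \<sigma> * q * x)) \<partial>lborel)"
    using assms by (intro nn_integral_real_affine) auto
  moreover have "\<bar>\<sigma> * q\<bar> = q" using assms by auto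
  ultimately show "(\<integral>\<^sup>+y. ennreal (?f y) \<partial>lborel) = ennreal (q * (s / q) powr p / p)"
    using assms by (simp add: ennreal_mult[symmetric] mult.commute)
qed (use assms in auto)

lemma has_bochner_integral_powr_dist_ball:
  fixes p q s c :: real
  assumes "0 < p" "0 < q" "0 \<le> s"
  shows "has_bochner_integral lborel
    (\<lambda>y. indicator {c - s..c + s} y * (\<bar>y - c\<bar> / q) powr (p - 1)) (2 * q * (s / q) powr p / p)"
proof -
  let ?f = "\<lambda>\<sigma> y. indicator {y. 0 \<le> \<sigma> * (y - c) \<and> \<sigma> * (y - c) \<le> s} y * (\<bar>y - c\<bar> / q) powr (p - 1)"
  have "has_bochner_integral lborel (\<lambda>y. ?f 1 y + ?f (- 1) y)
      (q * (s / q) powr p / p + q * (s / q) powr p / p)"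
    using assms by (intro has_bochner_integral_add has_bochner_integral_powr_dist) auto
  also have "q * (s / q) powr p / p + q * (s / q) powr p / p = 2 * q * (s / q) powr p / p" by simp
  also have "(\<lambda>y. ?f 1 y + ?f (- 1) y) = (\<lambda>y. indicator {c - s..c + s} y * (\<bar>y - c\<bar> / q) powr (p - 1))"
    using assms by (auto simp: fun_eq_iff indicator_def)
  finally show ?thesis .
qed

context interval_tree
begin

lemma phi_measurable [measurable]: "phi \<alpha> \<in> borel_measurable borel"
  unfolding phi_def by measurable

lemma psi_measurable [measurable]: "psi \<alpha> \<in> borel_measurable borel"
  unfolding psi_def by measurable

lemma h_measurable [measurable]: "h \<alpha> t \<in> borel_measurable borel"
  unfolding h_def by measurable

lemma W_measurable [measurable]: "W t A \<in> borel_measurable borel"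
  unfolding W_def by measurable

text \<open>The core of the interval: outside it \<open>h \<alpha>\<close> is \<open>1\<close>. Its
  radius is half the depth \<open>g * L \<alpha>\<close> of the centre, so it keeps away from the
  end points and from the centres of all ancestors.\<close>

definition zone :: "'a \<Rightarrow> real set" where
  "zone \<alpha> = {m \<alpha> - g * L \<alpha> / 2..m \<alpha> + g * L \<alpha> / 2}"

lemma zone_measurable [measurable]: "zone \<alpha> \<in> sets borel"
  by (simp add: zone_def)

lemma zone_iff: "y \<in> zone \<alpha> \<longleftrightarrow> \<bar>y - m \<alpha>\<bar> \<le> g * L \<alpha> / 2"
  unfolding zone_def atLeastAtMost_iff by linarith

text \<open>Centres of ancestors are at least \<open>g * L \<alpha>\<close> away from
  \<open>m \<alpha>\<close>, twice the radius of the zone, as the oscillation estimate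
  demands.\<close>

lemma W_anc_oscillation:
  assumes "\<alpha> \<in> At" "\<And>\<beta>. \<beta> \<in> anc \<alpha> \<Longrightarrow> \<bar>t \<beta>\<bar> \<le> 1 / 2" "y \<in> zone \<alpha>" "z \<in> zone \<alpha>"
  shows "W t (anc \<alpha>) y \<le> exp K * W t (anc \<alpha>) z"
proof (rule W_oscillation[where r = "g * L \<alpha> / 2" and x = "m \<alpha>"])
  show "below \<beta> \<gamma> \<or> below \<gamma> \<beta>" if "\<beta> \<in> anc \<alpha>" "\<gamma> \<in> anc \<alpha>" "\<beta> \<noteq> \<gamma>" for \<beta> \<gamma>
    using anc_nested assms that by blast
  show "2 * (g * L \<alpha> / 2) \<le> \<bar>m \<beta> - m \<alpha>\<bar>" if "\<beta> \<in> anc \<alpha>" for \<beta>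
    using below_m_dist[of \<alpha> \<beta>] that assms by (auto simp: anc_def)
  show "2 * (g * L \<alpha> / 2) / g \<le> L \<beta>" if "\<beta> \<in> anc \<alpha>" for \<beta>
    using below_L_less[of \<alpha> \<beta>] that assms g by (auto simp: anc_def)
qed (use assms finite_anc gL_pos in \<open>auto simp: zone_iff anc_def\<close>)

lemma W_anc_pos:
  assumes "\<alpha> \<in> At" "\<And>\<beta>. \<beta> \<in> anc \<alpha> \<Longrightarrow> \<bar>t \<beta>\<bar> \<le> 1 / 2"
  shows "0 < W t (anc \<alpha>) (m \<alpha>)"
  using below_m_dist[of \<alpha>] gL_pos[of \<alpha>] assms by (intro W_pos) (force simp: anc_def)+

text \<open>The condition is linear in \<open>r\<close>: with \<open>w\<close> the product over the
  ancestors, the solution is \<open>A1 / A2\<close>, where \<open>A1\<close> integrates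
  \<open>(1 - phi) * w\<close> and \<open>A2\<close> integrates \<open>phi * psi * w\<close> over
  the zone. The narrow support of \<open>1 - phi\<close> makes the quotient small.\<close>

lemma exists_mass_preserving:
  assumes \<alpha>: "\<alpha> \<in> At" and t: "\<And>\<beta>. \<beta> \<in> anc \<alpha> \<Longrightarrow> \<bar>t \<beta>\<bar> \<le> 1 / 2"
  shows "\<exists>r. \<bar>r\<bar> \<le> 1 / 2 \<and>
    (\<integral>\<^sup>+y. ennreal (h \<alpha> r y * W t (anc \<alpha>) y) * indicator (zone \<alpha>) y \<partial>lborel) =
    (\<integral>\<^sup>+y. ennreal (W t (anc \<alpha>) y) * indicator (zone \<alpha>) y \<partial>lborel)"
proof -
  define w where "w = W t (anc \<alpha>)"
  define w0 where "w0 = w (m \<alpha>)"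
  define q where "q = eta * L \<alpha>"
  let ?Z = "zone \<alpha>"
  have q: "0 < q" "q \<le> g * L \<alpha> / 64"
    using eta_pos L_pos[OF \<alpha>] eta_le mult_right_mono[of eta "g / 64" "L \<alpha>"] by (auto simp: q_def)
  have gL: "0 < g * L \<alpha>" by (rule gL_pos[OF \<alpha>])
  have mZ: "m \<alpha> \<in> ?Z" using gL by (simp add: zone_iff)
  have w0: "0 < w0" using W_anc_pos[OF \<alpha> t] by (simp add: w0_def w_def)
  have w_upper: "w y \<le> exp K * w0" if "y \<in> ?Z" for y
    using W_anc_oscillation[OF \<alpha> t that mZ] by (simp add: w_def w0_def)
  have w_lower: "exp (- K) * w0 \<le> w y" if "y \<in> ?Z" for y
    using W_anc_oscillation[OF \<alpha> t mZ that] by (simp add: w_def w0_def exp_minus field_simps)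
  have w_nonneg: "0 \<le> w y" for y
    unfolding w_def W_def by (intro prod_nonneg ballI h_nonneg t) (auto simp: anc_def)
  have w_meas [measurable]: "w \<in> borel_measurable borel" by (simp add: w_def)
  let ?P = "\<lambda>y. indicator {m \<alpha> - q..m \<alpha> + q} y * (\<bar>y - m \<alpha>\<bar> / q) powr (p - 1)"
  have P: "has_bochner_integral lborel ?P (2 * q / p)"
    using has_bochner_integral_powr_dist_ball[of p q q "m \<alpha>"] p q by simp
  have I: "has_bochner_integral lborel (indicator {u..v} :: real \<Rightarrow> real) (v - u)" if "u \<le> v" for u v
    using has_bochner_integral_real_indicator[of "{u..v}" lborel] that by simp
  have phi_le: "\<bar>1 - phi \<alpha> y\<bar> \<le> indicator {m \<alpha> - q..m \<alpha> + q} y + ?P y" for y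
  proof (cases "\<bar>y - m \<alpha>\<bar> \<le> q")
    case True
    then have "phi \<alpha> y = (\<bar>y - m \<alpha>\<bar> / q) powr (p - 1)"
      using q by (simp add: phi_def q_def[symmetric] min_def)
    moreover have "y \<in> {m \<alpha> - q..m \<alpha> + q}" using True by (auto simp: abs_le_iff)
    ultimately show ?thesis using phi_nonneg[of \<alpha> y] by (simp add: abs_le_iff)
  next
    case False
    then show ?thesis using phi_eq_1[OF \<alpha>, of y] by (simp add: q_def)
  qed
  let ?f1 = "\<lambda>y. indicator ?Z y * ((1 - phi \<alpha> y) * w y)"
  let ?f2 = "\<lambda>y. indicator ?Z y * (phi \<alpha> y * psi \<alpha> y * w y)"
  let ?f3 = "\<lambda>y. indicator ?Z y * w y"
  let ?b = "\<lambda>y. (indicator {m \<alpha> - q..m \<alpha> + q} y + ?P y) * (exp K * w0)"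
  have b: "has_bochner_integral lborel ?b ((2 * q + 2 * q / p) * (exp K * w0))"
  proof -
    have "has_bochner_integral lborel (\<lambda>y. indicator {m \<alpha> - q..m \<alpha> + q} y + ?P y) (2 * q + 2 * q / p)"
      using has_bochner_integral_add[OF I P, of "m \<alpha> - q" "m \<alpha> + q"] q by simp
    then show ?thesis by (intro has_bochner_integral_mult_left)
  qed
  have f1_le: "\<bar>?f1 y\<bar> \<le> ?b y" for y
  proof (cases "y \<in> ?Z")
    case True
    then have "\<bar>?f1 y\<bar> = \<bar>1 - phi \<alpha> y\<bar> * w y" by (simp add: abs_mult w_nonneg)
    also have "\<dots> \<le> ?b y"
      using phi_le[of y] w_upper[OF True] w_nonneg[of y] by (intro mult_mono) auto
    finally show ?thesis .
  qed (use w0 in auto)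
  have f1: "integrable lborel ?f1"
    using integrable.intros[OF b] by (rule Bochner_Integration.integrable_bound)
      (use f1_le in \<open>auto intro!: AE_I2 intro: order_trans[OF _ abs_ge_self]\<close>)
  have f3: "integrable lborel ?f3"
  proof (rule Bochner_Integration.integrable_bound)
    show "integrable lborel (\<lambda>y. indicator ?Z y * (exp K * w0))"
      using integrable.intros[OF I[of "m \<alpha> - g * L \<alpha> / 2" "m \<alpha> + g * L \<alpha> / 2"]] gL
      by (simp add: zone_def)
    show "AE y in lborel. norm (?f3 y) \<le> norm (indicator ?Z y * (exp K * w0))"
      using w_upper w_nonneg w0 by (auto simp: indicator_def abs_mult)
  qed measurable
  \<comment> \<open>For \<open>p < 1\<close> the function \<open>phi\<close> is unbounded, so
    integrability of \<open>phi * w\<close> is obtained by subtracting \<open>?f1\<close> from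
    \<open>?f3\<close>.\<close>
  have f4: "integrable lborel (\<lambda>y. indicator ?Z y * (phi \<alpha> y * w y))"
    using Bochner_Integration.integrable_diff[OF f3 f1] by (simp add: algebra_simps)
  have f2: "integrable lborel ?f2"
  proof (rule Bochner_Integration.integrable_bound[OF f4])
    show "AE y in lborel. norm (?f2 y) \<le> norm (indicator ?Z y * (phi \<alpha> y * w y))"
    proof (rule AE_I2)
      fix y
      have "phi \<alpha> y * psi \<alpha> y \<le> phi \<alpha> y * 1"
        using psi_bounds[of \<alpha> y] \<alpha> phi_nonneg[of \<alpha> y] by (intro mult_left_mono) auto
      then show "norm (?f2 y) \<le> norm (indicator ?Z y * (phi \<alpha> y * w y))"
        using w_nonneg[of y] phi_nonneg[of \<alpha> y] psi_bounds[of \<alpha> y] \<alpha>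
        by (auto simp: indicator_def abs_mult intro!: mult_right_mono)
    qed
  qed measurable
  define A1 A2 where "A1 = integral\<^sup>L lborel ?f1" and "A2 = integral\<^sup>L lborel ?f2"
  have A1: "\<bar>A1\<bar> \<le> (2 * q + 2 * q / p) * (exp K * w0)"
  proof -
    have "\<bar>A1\<bar> \<le> integral\<^sup>L lborel (\<lambda>y. \<bar>?f1 y\<bar>)" unfolding A1_def by (rule integral_abs_bound)
    also have "\<dots> \<le> integral\<^sup>L lborel ?b"
      using f1 integrable.intros[OF b] f1_le by (intro integral_mono) auto
    also have "\<dots> = (2 * q + 2 * q / p) * (exp K * w0)"
      by (rule has_bochner_integral_integral_eq[OF b])
    finally show ?thesis .
  qed
  \<comment> \<open>Only the piece from \<open>g * L \<alpha> / 8\<close> to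
    \<open>g * L \<alpha> / 4\<close> right of the centre is used: there \<open>phi\<close> is
    already \<open>1\<close> because \<open>q\<close> \<le> \<open>g * L \<alpha> / 64\<close>, and
    \<open>psi\<close> is still at least \<open>1 / 2\<close>.\<close>
  have A2: "g * L \<alpha> / 8 * (exp (- K) * w0 / 2) \<le> A2"
  proof -
    let ?u = "m \<alpha> + g * L \<alpha> / 8" and ?v = "m \<alpha> + g * L \<alpha> / 4"
    have c: "has_bochner_integral lborel (\<lambda>y. indicator {?u..?v} y * (exp (- K) * w0 / 2))
        ((?v - ?u) * (exp (- K) * w0 / 2))"
      using I[of ?u ?v] gL by (intro has_bochner_integral_mult_left) auto
    have "g * L \<alpha> / 8 * (exp (- K) * w0 / 2) = integral\<^sup>L lborel (\<lambda>y. indicator {?u..?v} y * (exp (- K) * w0 / 2))"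
      using has_bochner_integral_integral_eq[OF c] gL by simp
    also have "\<dots> \<le> A2" unfolding A2_def
    proof (rule integral_mono)
      fix y
      show "indicator {?u..?v} y * (exp (- K) * w0 / 2) \<le> ?f2 y"
      proof (cases "y \<in> {?u..?v}")
        case True
        have y: "g * L \<alpha> / 8 \<le> \<bar>y - m \<alpha>\<bar>" "\<bar>y - m \<alpha>\<bar> \<le> g * L \<alpha> / 4"
          using True gL by (auto simp: abs_if)
        then have yZ: "y \<in> ?Z" using gL by (simp add: zone_iff)
        have "phi \<alpha> y = 1" using phi_eq_1[OF \<alpha>, of y] q y by (simp add: q_def)
        moreover have "1 / 2 \<le> psi \<alpha> y" using y gL by (auto simp: psi_def max_def field_simps)
        moreover have "1 / 2 * (exp (- K) * w0) \<le> psi \<alpha> y * w y"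
          using w_lower[OF yZ] calculation w0 by (intro mult_mono) auto
        ultimately show ?thesis using True yZ by simp
      next
        case False
        then show ?thesis
          using w_nonneg[of y] phi_nonneg[of \<alpha> y] psi_bounds[of \<alpha> y] \<alpha> by simp
      qed
    qed (use f2 integrable.intros[OF c] in auto)
    finally show ?thesis .
  qed
  have A2_pos: "0 < A2" using A2 gL w0 by (smt (verit) divide_pos_pos exp_gt_zero mult_pos_pos)
  have bound: "\<bar>A1 / A2\<bar> \<le> 1 / 2"
  proof -
    have "1 + 1 / p \<noteq> 0" using p by (smt (verit) divide_pos_pos)
    then have eta: "eta * (1 + 1 / p) = g / 64 * (exp (- K) * exp (- K))"
      by (simp add: eta_def exp_add[symmetric] exp_minus inverse_eq_divide)
    have "(2 * q + 2 * q / p) * (exp K * w0) = eta * (1 + 1 / p) * (2 * L \<alpha> * exp K * w0)"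
      by (simp add: q_def algebra_simps)
    also have "\<dots> = 1 / 2 * (g * L \<alpha> / 8 * (exp (- K) * w0 / 2)) * (exp (- K) * exp K)"
      unfolding eta by (simp add: mult_ac)
    also have "exp (- K) * exp K = 1" by (simp add: exp_add[symmetric])
    finally have "(2 * q + 2 * q / p) * (exp K * w0) = 1 / 2 * (g * L \<alpha> / 8 * (exp (- K) * w0 / 2))"
      by simp
    then have "\<bar>A1\<bar> \<le> 1 / 2 * A2" using A1 A2 by linarith
    then show ?thesis using A2_pos by (simp add: field_simps)
  qed
  define r where "r = A1 / A2"
  note bound = bound[folded r_def]
  have eq: "indicator ?Z y * (h \<alpha> r y * w y) = ?f3 y - ?f1 y + r * ?f2 y" for y
    by (simp add: h_def algebra_simps)
  have int_h: "integrable lborel (\<lambda>y. indicator ?Z y * (h \<alpha> r y * w y))"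
    unfolding eq using f1 f2 f3 by (intro Bochner_Integration.integrable_add
        Bochner_Integration.integrable_diff integrable_mult_right)
  have "integral\<^sup>L lborel (\<lambda>y. indicator ?Z y * (h \<alpha> r y * w y)) = integral\<^sup>L lborel ?f3 - A1 + r * A2"
    unfolding eq using f1 f2 f3 by (simp add: A1_def A2_def)
  then have *: "integral\<^sup>L lborel (\<lambda>y. indicator ?Z y * (h \<alpha> r y * w y)) = integral\<^sup>L lborel ?f3"
    using A2_pos by (simp add: r_def)
  have "(\<integral>\<^sup>+y. ennreal (indicator ?Z y * (h \<alpha> r y * w y)) \<partial>lborel) =
      (\<integral>\<^sup>+y. ennreal (?f3 y) \<partial>lborel)"
    using int_h f3 * h_nonneg[OF \<alpha> bound] w_nonneg
    by (subst (1 2) nn_integral_eq_integral) auto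
  moreover have "ennreal (indicator ?Z y * v) = ennreal v * indicator ?Z y" for v y
    by (auto simp: indicator_def)
  ultimately show ?thesis
    using bound by (intro exI[of _ r]) (simp add: w_def[symmetric])
qed

lemma wf_anc: "wf {(\<beta>, \<alpha>). \<alpha> \<in> At \<and> \<beta> \<in> anc \<alpha>}"
proof (rule wf_subset)
  show "{(\<beta>, \<alpha>). \<alpha> \<in> At \<and> \<beta> \<in> anc \<alpha>} \<subseteq> inv_image less_than (\<lambda>\<alpha>. card (anc \<alpha>))"
  proof clarify
    fix \<alpha> \<beta> assume *: "\<alpha> \<in> At" "\<beta> \<in> anc \<alpha>"
    then have "anc \<beta> \<subseteq> anc \<alpha>"
      using below_L_less[of \<alpha> \<beta>] below_L_less[of \<beta> \<alpha>] by (fastforce simp: anc_def below_def)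
    moreover have "\<beta> \<notin> anc \<beta>" by (simp add: anc_def below_def)
    ultimately have "anc \<beta> \<subset> anc \<alpha>" using * by blast
    then show "(\<beta>, \<alpha>) \<in> inv_image less_than (\<lambda>\<alpha>. card (anc \<alpha>))"
      using finite_anc[OF *(1)] by (simp add: psubset_card_mono)
  qed
qed simp

text \<open>The coefficient of \<open>\<alpha>\<close> depends only on those of its ancestors, so
  well-founded recursion constructs the family. The bound \<open>1 / 2\<close> is imposed for every
  element of the type, which spares later lemmas a membership condition on it.\<close>

lemma exists_mass_preserving_family:
  "\<exists>t. \<forall>\<alpha>. \<bar>t \<alpha>\<bar> \<le> 1 / 2 \<and> (\<alpha> \<in> At \<longrightarrow>
    (\<integral>\<^sup>+y. ennreal (h \<alpha> (t \<alpha>) y * W t (anc \<alpha>) y) * indicator (zone \<alpha>) y \<partial>lborel) =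
    (\<integral>\<^sup>+y. ennreal (W t (anc \<alpha>) y) * indicator (zone \<alpha>) y \<partial>lborel))"
proof (rule dependent_wf_choice[OF wf_anc])
  fix f f' :: "'a \<Rightarrow> real" and \<alpha> r
  assume "\<And>\<beta>. (\<beta>, \<alpha>) \<in> {(\<beta>, \<alpha>). \<alpha> \<in> At \<and> \<beta> \<in> anc \<alpha>} \<Longrightarrow> f \<beta> = f' \<beta>"
  then have "\<alpha> \<in> At \<Longrightarrow> W f (anc \<alpha>) = W f' (anc \<alpha>)"
    by (auto simp: W_def fun_eq_iff intro!: prod.cong)
  then show "(\<bar>r\<bar> \<le> 1 / 2 \<and> (\<alpha> \<in> At \<longrightarrow>
    (\<integral>\<^sup>+y. ennreal (h \<alpha> r y * W f (anc \<alpha>) y) * indicator (zone \<alpha>) y \<partial>lborel) =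
    (\<integral>\<^sup>+y. ennreal (W f (anc \<alpha>) y) * indicator (zone \<alpha>) y \<partial>lborel))) =
    (\<bar>r\<bar> \<le> 1 / 2 \<and> (\<alpha> \<in> At \<longrightarrow>
    (\<integral>\<^sup>+y. ennreal (h \<alpha> r y * W f' (anc \<alpha>) y) * indicator (zone \<alpha>) y \<partial>lborel) =
    (\<integral>\<^sup>+y. ennreal (W f' (anc \<alpha>) y) * indicator (zone \<alpha>) y \<partial>lborel)))"
    by auto
next
  fix \<alpha> :: 'a and f :: "'a \<Rightarrow> real"
  assume *: "\<And>\<beta>. (\<beta>, \<alpha>) \<in> {(\<beta>, \<alpha>). \<alpha> \<in> At \<and> \<beta> \<in> anc \<alpha>} \<Longrightarrow> \<bar>f \<beta>\<bar> \<le> 1 / 2 \<and> (\<beta> \<in> At \<longrightarrow>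
    (\<integral>\<^sup>+y. ennreal (h \<beta> (f \<beta>) y * W f (anc \<beta>) y) * indicator (zone \<beta>) y \<partial>lborel) =
    (\<integral>\<^sup>+y. ennreal (W f (anc \<beta>) y) * indicator (zone \<beta>) y \<partial>lborel))"
  show "\<exists>r. \<bar>r\<bar> \<le> 1 / 2 \<and> (\<alpha> \<in> At \<longrightarrow>
    (\<integral>\<^sup>+y. ennreal (h \<alpha> r y * W f (anc \<alpha>) y) * indicator (zone \<alpha>) y \<partial>lborel) =
    (\<integral>\<^sup>+y. ennreal (W f (anc \<alpha>) y) * indicator (zone \<alpha>) y \<partial>lborel))"
  proof (cases "\<alpha> \<in> At")
    case True
    then show ?thesis using exists_mass_preserving[of \<alpha> f] * by auto
  qed (auto intro: exI[of _ 0])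
qed

end

subsection \<open>Comparison of masses at a given scale\<close>

lemma powr_between_one:
  fixes x s a :: real
  assumes "0 < s" "min 1 s \<le> x" "x \<le> max 1 s"
  shows "x powr a \<le> 1 + s powr a"
proof (cases "0 \<le> a")
  case True
  have "x powr a \<le> max 1 s powr a" using assms True by (intro powr_mono2) auto
  then show ?thesis by (auto simp: max_def split: if_splits intro: order_trans)
next
  case False
  have "x powr a \<le> min 1 s powr a" using assms False by (intro powr_mono2') auto
  then show ?thesis by (auto simp: min_def split: if_splits intro: order_trans)
qed

lemma powr_abs_bounds:
  fixes x s a :: real
  assumes "0 < s" "s \<le> x" "x \<le> 1 / s"
  shows "s powr \<bar>a\<bar> \<le> x powr a" "x powr a \<le> (1 / s) powr \<bar>a\<bar>"
proof -
  have x: "0 < x" using assms by linarith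
  have ix: "s \<le> 1 / x" "1 / x \<le> 1 / s" using assms x by (auto simp: field_simps)
  have inv: "(1 / x) powr b = x powr (- b)" for b using x by (simp add: powr_divide powr_minus_divide)
  show "s powr \<bar>a\<bar> \<le> x powr a"
    using assms x ix inv[of "\<bar>a\<bar>"] powr_mono2[of "\<bar>a\<bar>" s x] powr_mono2[of "\<bar>a\<bar>" s "1 / x"]
    by (cases "0 \<le> a") auto
  show "x powr a \<le> (1 / s) powr \<bar>a\<bar>"
    using assms x ix inv[of "\<bar>a\<bar>"] powr_mono2[of "\<bar>a\<bar>" x "1 / s"] powr_mono2[of "\<bar>a\<bar>" "1 / x" "1 / s"]
    by (cases "0 \<le> a") auto
qed

lemma min_one_ratio_bounds:
  fixes u v :: real
  assumes "0 < u" "0 < v"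
  shows "min 1 (u / v) \<le> min 1 u / min 1 v" "min 1 u / min 1 v \<le> max 1 (u / v)"
  using assms by (auto simp: min_def max_def field_simps)

text \<open>Replaces a product of singular factors by a sum, which can be integrated term by term.
  It applies because a point cannot be close to two separated centres at once.\<close>

lemma prod_le_if_at_most_one_large:
  fixes v :: "'a \<Rightarrow> real"
  assumes "finite S" "1 \<le> U" "\<And>x. x \<in> S \<Longrightarrow> 0 \<le> v x"
    and "\<And>x y. x \<in> S \<Longrightarrow> y \<in> S \<Longrightarrow> x \<noteq> y \<Longrightarrow> v x \<le> U \<or> v y \<le> U"
  shows "prod v S \<le> U ^ card S * (1 + sum v S)"
proof (cases "\<exists>z\<in>S. U < v z")
  case True
  then obtain z where z: "z \<in> S" "U < v z" by blast
  have "prod v (S - {z}) \<le> prod (\<lambda>_. U) (S - {z})"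
    using assms z by (intro prod_mono) force
  also have "\<dots> \<le> U ^ card S" using assms z by (auto intro!: power_increasing)
  finally have "v z * prod v (S - {z}) \<le> v z * U ^ card S" using assms z by (intro mult_left_mono) auto
  also have "\<dots> \<le> U ^ card S * (1 + sum v S)"
    using member_le_sum[of z S v] assms z by (subst mult.commute, intro mult_left_mono) auto
  finally show ?thesis using prod.remove[of S z v] assms z by simp
next
  case False
  have "prod v S \<le> prod (\<lambda>_. U) S" using assms False by (intro prod_mono) force
  also have "\<dots> \<le> U ^ card S * (1 + sum v S)"
    using assms sum_nonneg[of S v] by (simp add: mult_le_cancel_left1)
  finally show ?thesis .
qed

context interval_tree
begin

text \<open>The value of \<open>phi \<alpha>\<close> at distance \<open>r\<close> from its
  centre.\<close>

definition level :: "'a \<Rightarrow> real \<Rightarrow> real" where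
  "level \<alpha> r = min 1 (r / (eta * L \<alpha>)) powr (p - 1)"

lemma level_pos: "\<alpha> \<in> At \<Longrightarrow> 0 < r \<Longrightarrow> 0 < level \<alpha> r"
  using L_pos[of \<alpha>] eta_pos by (simp add: level_def min_def)

text \<open>Dividing by \<open>level\<close> leaves bounds in the distance to the centre in units of
  \<open>r\<close>, free of \<open>L \<alpha>\<close> and \<open>eta\<close>. This lets one constant
  serve all intervals.\<close>

lemma phi_eq_level:
  assumes "\<alpha> \<in> At" "0 < r" "y \<noteq> m \<alpha>"
  obtains \<rho> where "phi \<alpha> y = \<rho> powr (p - 1) * level \<alpha> r"
    "min 1 (\<bar>y - m \<alpha>\<bar> / r) \<le> \<rho>" "\<rho> \<le> max 1 (\<bar>y - m \<alpha>\<bar> / r)"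
proof -
  define q where "q = eta * L \<alpha>"
  have q: "0 < q" using L_pos eta_pos assms by (simp add: q_def)
  define u v where "u = \<bar>y - m \<alpha>\<bar> / q" and "v = r / q"
  have uv: "0 < u" "0 < v" using q assms by (auto simp: u_def v_def)
  have uv_eq: "u / v = \<bar>y - m \<alpha>\<bar> / r" using q by (simp add: u_def v_def)
  have "phi \<alpha> y = min 1 u powr (p - 1)" "level \<alpha> r = min 1 v powr (p - 1)"
    unfolding phi_def level_def u_def v_def q_def by (rule refl)+
  then have "phi \<alpha> y = (min 1 u / min 1 v) powr (p - 1) * level \<alpha> r"
    using uv by (simp add: powr_divide)
  then show ?thesis
    using min_one_ratio_bounds[OF uv] unfolding uv_eq by (rule that)
qed

lemma h_le_level:
  assumes "\<alpha> \<in> At" "\<bar>t\<bar> \<le> 1 / 2" "0 < r"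
  shows "h \<alpha> t y \<le> 3 / 2 * (1 + (\<bar>y - m \<alpha>\<bar> / r) powr (p - 1)) * level \<alpha> r"
proof (cases "y = m \<alpha>")
  case True
  then show ?thesis using level_pos[of \<alpha> r] assms by (simp add: h_def phi_def)
next
  case False
  then obtain \<rho> where \<rho>: "phi \<alpha> y = \<rho> powr (p - 1) * level \<alpha> r"
    "min 1 (\<bar>y - m \<alpha>\<bar> / r) \<le> \<rho>" "\<rho> \<le> max 1 (\<bar>y - m \<alpha>\<bar> / r)"
    using phi_eq_level assms by metis
  have "\<rho> powr (p - 1) \<le> 1 + (\<bar>y - m \<alpha>\<bar> / r) powr (p - 1)"
    using powr_between_one[OF _ \<rho>(2,3)] False assms by simp
  then have "phi \<alpha> y \<le> (1 + (\<bar>y - m \<alpha>\<bar> / r) powr (p - 1)) * level \<alpha> r"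
    unfolding \<rho>(1) using level_pos[of \<alpha> r] assms by (intro mult_right_mono) auto
  then have "phi \<alpha> y * (1 + t * psi \<alpha> y) \<le> (1 + (\<bar>y - m \<alpha>\<bar> / r) powr (p - 1)) * level \<alpha> r * (3 / 2)"
    using bump_bounds[OF assms(1,2), of y] phi_nonneg[of \<alpha> y] by (intro mult_mono) auto
  then show ?thesis by (simp add: h_def algebra_simps)
qed

lemma h_level_bounds:
  assumes "\<alpha> \<in> At" "\<bar>t\<bar> \<le> 1 / 2" "0 < r" "0 < s" "s \<le> 1 / 3" "s * r \<le> \<bar>y - m \<alpha>\<bar>" "\<bar>y - m \<alpha>\<bar> \<le> 3 * r"
  shows "1 / 2 * s powr \<bar>p - 1\<bar> * level \<alpha> r \<le> h \<alpha> t y"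
    "h \<alpha> t y \<le> 3 / 2 * (1 / s) powr \<bar>p - 1\<bar> * level \<alpha> r"
proof -
  have "0 < s * r" using assms by simp
  then have "0 < \<bar>y - m \<alpha>\<bar>" using assms(6) by linarith
  then have y: "y \<noteq> m \<alpha>" by auto
  then obtain \<rho> where \<rho>: "phi \<alpha> y = \<rho> powr (p - 1) * level \<alpha> r"
    "min 1 (\<bar>y - m \<alpha>\<bar> / r) \<le> \<rho>" "\<rho> \<le> max 1 (\<bar>y - m \<alpha>\<bar> / r)"
    using phi_eq_level assms by metis
  have "s \<le> \<bar>y - m \<alpha>\<bar> / r" "\<bar>y - m \<alpha>\<bar> / r \<le> 3" using assms by (auto simp: field_simps)
  moreover have "3 \<le> 1 / s" using assms by (simp add: field_simps)
  ultimately have s: "s \<le> \<rho>" "\<rho> \<le> 1 / s" using \<rho> assms by (auto simp: min_def max_def split: if_splits)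
  have l: "0 < level \<alpha> r" using level_pos assms by blast
  note b = powr_abs_bounds[OF assms(4) s, of "p - 1"]
  have "s powr \<bar>p - 1\<bar> * level \<alpha> r * (1 / 2) \<le> phi \<alpha> y * (1 + t * psi \<alpha> y)"
    unfolding \<rho>(1) using b l bump_bounds[OF assms(1,2), of y] by (intro mult_mono) auto
  then show "1 / 2 * s powr \<bar>p - 1\<bar> * level \<alpha> r \<le> h \<alpha> t y" by (simp add: h_def mult_ac)
  have "phi \<alpha> y * (1 + t * psi \<alpha> y) \<le> (1 / s) powr \<bar>p - 1\<bar> * level \<alpha> r * (3 / 2)"
    unfolding \<rho>(1) using b l bump_bounds[OF assms(1,2), of y] by (intro mult_mono) auto
  then show "h \<alpha> t y \<le> 3 / 2 * (1 / s) powr \<bar>p - 1\<bar> * level \<alpha> r" by (simp add: h_def mult_ac)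
qed

text \<open>At scale \<open>r\<close> only boundedly many centres are near; the intervals with far centres whose
  zone still meets the ball are nested, so they contribute an almost constant factor.\<close>

lemma N_ball_comparison:
  assumes \<delta>: "0 < \<delta>" "\<delta> \<le> 1"
  shows "\<exists>C>0. \<forall>t A x r. (\<forall>\<alpha>. \<bar>t \<alpha>\<bar> \<le> 1 / 2) \<longrightarrow> finite A \<and> A \<subseteq> At \<longrightarrow> 0 < r \<longrightarrow> (\<forall>\<alpha>\<in>A. \<delta> * r \<le> L \<alpha>) \<longrightarrow>
    (\<exists>\<kappa>>0. emeasure (N t A) {x - r..x + r} \<le> ennreal (C * \<kappa>) \<and>
      (\<forall>B\<in>sets borel. B \<subseteq> {x - r..x + r} \<longrightarrow> ennreal (\<delta> * r) \<le> emeasure lborel B \<longrightarrow>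
        ennreal \<kappa> \<le> emeasure (N t A) B))"
proof -
  \<comment> \<open>Bounds the number of centres within \<open>2 * r\<close> of \<open>x\<close>,
    which are pairwise at least \<open>g * \<delta> * r\<close> apart.\<close>
  define n where "n = nat \<lceil>4 / (g * \<delta>) + 2\<rceil>"
  have gd: "0 < g * \<delta>" using g \<delta> by simp
  have n: "4 / (g * \<delta>) + 2 \<le> real n" unfolding n_def by linarith
  moreover have "0 < 4 / (g * \<delta>)" using gd by simp
  ultimately have "1 \<le> real n" by linarith
  then have n1: "1 \<le> real n" "0 < n" by auto
  \<comment> \<open>Half of that separation in units of \<open>r\<close>: no point is closer than
    \<open>s1 * r\<close> to two of these centres.\<close>
  define s1 where "s1 = g * \<delta> / 2"
  have "g * \<delta> \<le> 1 / 2 * 1" using g \<delta> by (intro mult_mono) auto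
  then have s1: "0 < s1" "s1 \<le> 1 / 3" using gd by (auto simp: s1_def)
  \<comment> \<open>Intervals of radius \<open>s2 * r\<close> around \<open>n\<close> centres have
    total length \<open>\<delta> * r / 2\<close>, half the least length of \<open>B\<close>.\<close>
  define s2 where "s2 = \<delta> / (4 * real n)"
  have s2: "0 < s2" "s2 \<le> 1 / 3" using n1 \<delta> by (auto simp: s2_def field_simps)
  define U where "U = 3 / 2 * (1 / s1) powr \<bar>p - 1\<bar>"
  define V where "V = 1 / 2 * s2 powr \<bar>p - 1\<bar>"
  have "1 \<le> (1 / s1) powr \<bar>p - 1\<bar>" using s1 by (intro ge_one_powr_ge_zero) auto
  then have U: "1 \<le> U" by (simp add: U_def)
  have "s2 powr \<bar>p - 1\<bar> \<le> 1" using s2 by (intro powr_le1) auto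
  then have V: "0 < V" "V \<le> 1" using s2 by (auto simp: V_def)
  define D where "D = 2 + real n * (3 / 2 * (2 + 2 * 3 powr p / p))"
  have D: "0 < D" unfolding D_def using n1 p by (intro add_pos_nonneg mult_nonneg_nonneg) auto
  define C where "C = exp K * U ^ n * D / (V ^ n * exp (- K) * \<delta> / 2)"
  have C: "0 < C" unfolding C_def using U V D \<delta> by (intro divide_pos_pos mult_pos_pos) auto
  show ?thesis
  proof (rule exI[of _ C], rule conjI[OF C], intro allI impI)
    fix t :: "'a \<Rightarrow> real" and A x r
    assume "\<forall>\<alpha>. \<bar>t \<alpha>\<bar> \<le> 1 / 2" and "finite A \<and> A \<subseteq> At" and r: "0 < r" and "\<forall>\<alpha>\<in>A. \<delta> * r \<le> L \<alpha>"
    then have t: "\<And>\<alpha>. \<bar>t \<alpha>\<bar> \<le> 1 / 2" and A: "finite A" "A \<subseteq> At"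
      and large: "\<And>\<alpha>. \<alpha> \<in> A \<Longrightarrow> \<delta> * r \<le> L \<alpha>" by auto
    define B0 where "B0 = {x - r..x + r}"
    \<comment> \<open>All other weights equal \<open>1\<close> on the ball. Those in
      \<open>S\<close> are few and may be singular; those in \<open>F\<close> are nearly constant
      together.\<close>
    define S where "S = {\<alpha>\<in>A. \<bar>m \<alpha> - x\<bar> \<le> 2 * r}"
    define F where "F = {\<alpha>\<in>A. 2 * r < \<bar>m \<alpha> - x\<bar> \<and> zone \<alpha> \<inter> B0 \<noteq> {}}"
    have fin: "finite S" "finite F" "S \<subseteq> At" "F \<subseteq> At" "S \<inter> F = {}" using A by (auto simp: S_def F_def)
    have B0: "y \<in> B0 \<longleftrightarrow> \<bar>y - x\<bar> \<le> r" for y unfolding B0_def atLeastAtMost_iff by linarith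
    have sep: "g * \<delta> * r \<le> \<bar>m \<alpha> - m \<beta>\<bar>" if "\<alpha> \<in> S" "\<beta> \<in> S" "\<alpha> \<noteq> \<beta>" for \<alpha> \<beta>
    proof -
      have "g * (\<delta> * r) \<le> g * min (L \<alpha>) (L \<beta>)"
        using large that g by (intro mult_left_mono) (auto simp: S_def)
      also have "\<dots> \<le> \<bar>m \<alpha> - m \<beta>\<bar>" using that fin by (intro m_separated) auto
      finally show ?thesis by (simp add: mult.assoc)
    qed
    have "real (card S) \<le> 2 * (2 * r) / (g * \<delta> * r) + 2"
      using fin sep gd r by (intro card_separated_le[where f = m and c = x]) (auto simp: S_def)
    also have "\<dots> = 4 / (g * \<delta>) + 2" using r by simp
    finally have card: "card S \<le> n" using n by linarith
    \<comment> \<open>A zone whose centre is beyond \<open>2 * r\<close> can reach the ball only if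
      its radius \<open>g * L \<alpha> / 2\<close> exceeds \<open>r\<close>.\<close>
    have farL: "2 * r < g * L \<alpha>" if \<alpha>: "\<alpha> \<in> F" for \<alpha>
    proof -
      obtain y where "y \<in> zone \<alpha>" "y \<in> B0" using \<alpha> by (auto simp: F_def)
      then have "\<bar>y - m \<alpha>\<bar> \<le> g * L \<alpha> / 2" "\<bar>y - x\<bar> \<le> r" by (auto simp: zone_iff B0)
      moreover have "2 * r < \<bar>m \<alpha> - x\<bar>" using \<alpha> by (auto simp: F_def)
      moreover have "\<bar>m \<alpha> - x\<bar> \<le> \<bar>y - m \<alpha>\<bar> + \<bar>y - x\<bar>" by linarith
      ultimately show ?thesis by argo
    qed
    \<comment> \<open>Zones stay \<open>g * L / 2\<close> away from the ends of their intervals, so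
      two of them in intervals without common interior would be more than \<open>2 * r\<close>
      apart, the length of \<open>B0\<close>. Hence \<open>F\<close> is nested.\<close>
    have disj: False if \<alpha>\<beta>: "\<alpha> \<in> F" "\<beta> \<in> F" "hi \<beta> \<le> lo \<alpha>" for \<alpha> \<beta>
    proof -
      obtain y z where "y \<in> zone \<alpha>" "y \<in> B0" "z \<in> zone \<beta>" "z \<in> B0" using \<alpha>\<beta> by (auto simp: F_def)
      moreover have "m \<alpha> \<ge> lo \<alpha> + g * L \<alpha>" "m \<beta> + g * L \<beta> \<le> hi \<beta>"
        using m_ends \<alpha>\<beta> fin by (auto simp: subset_iff)
      ultimately show False
        using \<alpha>\<beta>(3) farL[OF \<alpha>\<beta>(1)] farL[OF \<alpha>\<beta>(2)] by (simp add: zone_def B0_def)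
    qed
    have osc: "W t F y \<le> exp K * W t F z" if "y \<in> B0" "z \<in> B0" for y z
    proof (rule W_oscillation[where r = r and x = x])
      show "below \<alpha> \<beta> \<or> below \<beta> \<alpha>" if "\<alpha> \<in> F" "\<beta> \<in> F" "\<alpha> \<noteq> \<beta>" for \<alpha> \<beta>
        using disj[of \<alpha> \<beta>] disj[of \<beta> \<alpha>] that fin by (intro overlap_nested) force+
      show "2 * r / g \<le> L \<alpha>" if "\<alpha> \<in> F" for \<alpha>
        using farL[OF that] g by (simp add: field_simps)
    qed (use fin t r that in \<open>auto simp: F_def B0\<close>)
    have xB0: "x \<in> B0" using r by (simp add: B0)
    define w0 where "w0 = W t F x"
    have w0: "0 < w0" unfolding w0_def using r fin t by (intro W_pos) (auto simp: F_def)
    have F_lower: "exp (- K) * w0 \<le> W t F y" if "y \<in> B0" for y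
      using osc[OF xB0 that] by (simp add: w0_def exp_minus field_simps)
    have F_upper: "W t F y \<le> exp K * w0" if "y \<in> B0" for y
      using osc[OF that xB0] by (simp add: w0_def)
    have W_split: "W t A y = W t S y * W t F y" if "y \<in> B0" for y
    proof -
      have "W t A y = (\<Prod>\<alpha>\<in>S \<union> F. h \<alpha> (t \<alpha>) y)" unfolding W_def
      proof (rule prod.mono_neutral_right)
        show "\<forall>\<alpha>\<in>A - (S \<union> F). h \<alpha> (t \<alpha>) y = 1"
        proof
          fix \<alpha> assume "\<alpha> \<in> A - (S \<union> F)"
          then have "\<alpha> \<in> At" "y \<notin> zone \<alpha>" using A that by (auto simp: S_def F_def)
          then show "h \<alpha> (t \<alpha>) y = 1" by (intro h_eq_1) (auto simp: zone_iff)
        qed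
      qed (use A in \<open>auto simp: S_def F_def\<close>)
      also have "\<dots> = W t S y * W t F y" unfolding W_def using fin by (intro prod.union_disjoint)
      finally show ?thesis .
    qed
    define k where "k = (\<Prod>\<alpha>\<in>S. level \<alpha> r)"
    have lev: "0 < level \<alpha> r" if "\<alpha> \<in> S" for \<alpha> using level_pos r fin that by blast
    have k: "0 < k" unfolding k_def by (intro prod_pos) (use lev in auto)
    have near3: "\<bar>y - m \<alpha>\<bar> \<le> 3 * r" if "y \<in> B0" "\<alpha> \<in> S" for y \<alpha>
    proof -
      have "\<bar>y - m \<alpha>\<bar> \<le> \<bar>y - x\<bar> + \<bar>m \<alpha> - x\<bar>" by linarith
      moreover have "\<bar>y - x\<bar> \<le> r" "\<bar>m \<alpha> - x\<bar> \<le> 2 * r" using that by (auto simp: B0 S_def)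
      ultimately show ?thesis by argo
    qed
    let ?s = "\<lambda>\<alpha> y. (\<bar>y - m \<alpha>\<bar> / r) powr (p - 1)"
    let ?P = "\<lambda>\<alpha> y. indicator {m \<alpha> - 3 * r..m \<alpha> + 3 * r} y * ?s \<alpha> y"
    \<comment> \<open>Integrable majorant of the near factors after division by their levels; its
      integral is at most \<open>r * D\<close>.\<close>
    let ?G = "\<lambda>y. indicator B0 y + (\<Sum>\<alpha>\<in>S. 3 / 2 * (indicator B0 y + ?P \<alpha> y))"
    have S_upper: "W t S y \<le> k * U ^ n * (1 + (\<Sum>\<alpha>\<in>S. 3 / 2 * (1 + ?s \<alpha> y)))" if y: "y \<in> B0" for y
    proof -
      define v where "v \<alpha> = h \<alpha> (t \<alpha>) y / level \<alpha> r" for \<alpha>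
      have v0: "0 \<le> v \<alpha>" if "\<alpha> \<in> S" for \<alpha>
        using h_nonneg[OF _ t, of \<alpha>] lev[OF that] fin that by (auto simp: v_def)
      have vU: "v \<alpha> \<le> U" if "\<alpha> \<in> S" "s1 * r \<le> \<bar>y - m \<alpha>\<bar>" for \<alpha>
        using h_level_bounds(2)[of \<alpha> "t \<alpha>" r s1 y] near3[OF y that(1)] lev[OF that(1)] that fin t r s1
        by (auto simp: v_def U_def divide_le_eq)
      have "prod v S \<le> U ^ card S * (1 + sum v S)"
      proof (rule prod_le_if_at_most_one_large)
        show "v \<alpha> \<le> U \<or> v \<beta> \<le> U" if "\<alpha> \<in> S" "\<beta> \<in> S" "\<alpha> \<noteq> \<beta>" for \<alpha> \<beta>
        proof -
          have "2 * (s1 * r) \<le> \<bar>m \<alpha> - m \<beta>\<bar>" using sep[OF that] by (simp add: s1_def mult.assoc)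
          moreover have "\<bar>m \<alpha> - m \<beta>\<bar> \<le> \<bar>y - m \<alpha>\<bar> + \<bar>y - m \<beta>\<bar>" by linarith
          ultimately have "s1 * r \<le> \<bar>y - m \<alpha>\<bar> \<or> s1 * r \<le> \<bar>y - m \<beta>\<bar>" by argo
          then show ?thesis using vU that by blast
        qed
      qed (use fin U v0 in auto)
      also have "\<dots> \<le> U ^ n * (1 + (\<Sum>\<alpha>\<in>S. 3 / 2 * (1 + ?s \<alpha> y)))"
      proof (intro mult_mono add_left_mono sum_mono)
        show "v \<alpha> \<le> 3 / 2 * (1 + ?s \<alpha> y)" if "\<alpha> \<in> S" for \<alpha>
          using h_le_level[of \<alpha> "t \<alpha>" r y] lev[OF that] fin that t r by (auto simp: v_def divide_le_eq)
      qed (use U v0 card in \<open>auto intro!: power_increasing add_nonneg_nonneg sum_nonneg\<close>)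
      finally have "k * prod v S \<le> k * (U ^ n * (1 + (\<Sum>\<alpha>\<in>S. 3 / 2 * (1 + ?s \<alpha> y))))"
        using k by (intro mult_left_mono) auto
      moreover have "W t S y = k * prod v S"
        unfolding W_def k_def prod.distrib[symmetric] v_def
      proof (rule prod.cong)
        show "h \<alpha> (t \<alpha>) y = level \<alpha> r * (h \<alpha> (t \<alpha>) y / level \<alpha> r)" if "\<alpha> \<in> S" for \<alpha>
          using lev[OF that] by simp
      qed simp
      ultimately show ?thesis by (simp add: mult.assoc)
    qed
    have "has_bochner_integral lborel (indicator B0 :: real \<Rightarrow> real) (2 * r)"
      using has_bochner_integral_real_indicator[of B0 lborel] r by (simp add: B0_def)
    moreover have "has_bochner_integral lborel (?P \<alpha>) (2 * r * (3 * r / r) powr p / p)" for \<alpha>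
      using p r by (intro has_bochner_integral_powr_dist_ball) auto
    ultimately have G: "has_bochner_integral lborel ?G
        (2 * r + (\<Sum>\<alpha>\<in>S. 3 / 2 * (2 * r + 2 * r * (3 * r / r) powr p / p)))"
      by (intro has_bochner_integral_add has_bochner_integral_sum has_bochner_integral_mult_right)
    let ?G1 = "2 * r + (\<Sum>\<alpha>\<in>S. 3 / 2 * (2 * r + 2 * r * (3 * r / r) powr p / p))"
    have "?G1 = r * (2 + real (card S) * (3 / 2 * (2 + 2 * 3 powr p / p)))"
      using r by (simp add: algebra_simps)
    also have "\<dots> \<le> r * D"
      unfolding D_def using r card p by (intro mult_left_mono add_left_mono mult_right_mono) auto
    finally have G1: "?G1 \<le> r * D" .
    define c1 where "c1 = exp K * w0 * k * U ^ n"
    have c1: "0 < c1" unfolding c1_def using w0 k U by (intro mult_pos_pos) auto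
    have "emeasure (N t A) B0 = (\<integral>\<^sup>+y. ennreal (W t A y) * indicator B0 y \<partial>lborel)"
      unfolding N_def by (subst emeasure_density) (auto simp: B0_def)
    also have "\<dots> \<le> (\<integral>\<^sup>+y. ennreal (c1 * ?G y) \<partial>lborel)"
    proof (rule nn_integral_mono)
      fix y
      show "ennreal (W t A y) * indicator B0 y \<le> ennreal (c1 * ?G y)"
      proof (cases "y \<in> B0")
        case True
        have "W t A y \<le> k * U ^ n * (1 + (\<Sum>\<alpha>\<in>S. 3 / 2 * (1 + ?s \<alpha> y))) * (exp K * w0)"
          unfolding W_split[OF True]
          using S_upper[OF True] F_upper[OF True] W_nonneg[OF fin(3) t] W_nonneg[OF fin(4) t] k U
          by (intro mult_mono mult_nonneg_nonneg add_nonneg_nonneg sum_nonneg) auto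
        also have "(\<Sum>\<alpha>\<in>S. 3 / 2 * (1 + ?s \<alpha> y)) = (\<Sum>\<alpha>\<in>S. 3 / 2 * (indicator B0 y + ?P \<alpha> y))"
        proof (rule sum.cong)
          fix \<alpha> assume "\<alpha> \<in> S"
          then have "y \<in> {m \<alpha> - 3 * r..m \<alpha> + 3 * r}"
            using near3[OF True] unfolding atLeastAtMost_iff by (smt (verit))
          then show "3 / 2 * (1 + ?s \<alpha> y) = 3 / 2 * (indicator B0 y + ?P \<alpha> y)" using True by simp
        qed simp
        finally have "W t A y \<le> c1 * ?G y" using True by (simp add: c1_def mult_ac)
        then show ?thesis using True by (simp add: ennreal_leI)
      qed simp
    qed
    also have "\<dots> = ennreal (c1 * ?G1)"
      using has_bochner_integral_mult_right[OF G, of c1] c1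
      by (subst nn_integral_eq_integral)
        (auto simp: has_bochner_integral_iff intro!: AE_I2 mult_nonneg_nonneg add_nonneg_nonneg sum_nonneg)
    also have "\<dots> \<le> ennreal (c1 * (r * D))" using G1 c1 by (intro ennreal_leI mult_left_mono) auto
    finally have upper: "emeasure (N t A) B0 \<le> ennreal (c1 * (r * D))" .
    define c2 where "c2 = V ^ n * k * (exp (- K) * w0)"
    have c2: "0 < c2" unfolding c2_def using w0 k V by (intro mult_pos_pos) auto
    \<comment> \<open>The local unit of mass: the smallest density off the removed intervals times
      the length that certainly survives. It varies with the ball and the family, while the ratio
      \<open>C\<close> of upper to lower bound does not.\<close>
    define \<kappa> where "\<kappa> = c2 * (\<delta> * r / 2)"
    have \<kappa>: "0 < \<kappa>" using c2 \<delta> r by (simp add: \<kappa>_def)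
    have "C * \<kappa> = c1 * (r * D)"
      using V \<delta> r by (simp add: C_def \<kappa>_def c1_def c2_def field_simps)
    moreover have "ennreal \<kappa> \<le> emeasure (N t A) B"
      if B: "B \<in> sets borel" "B \<subseteq> B0" "ennreal (\<delta> * r) \<le> emeasure lborel B" for B
    proof -
      let ?b = "\<lambda>\<alpha>. {m \<alpha> - s2 * r..m \<alpha> + s2 * r}"
      \<comment> \<open>Near the centres the density can be small when \<open>p > 1\<close>, so
        neighbourhoods of them are cut out of \<open>B\<close>; at least half of the required length
        is left.\<close>
      define H where "H = B - (\<Union>\<alpha>\<in>S. ?b \<alpha>)"
      have H: "H \<in> sets borel" unfolding H_def using B fin by (intro sets.Diff sets.finite_UN) auto
      have "ennreal (\<delta> * r / 2) + ennreal (\<delta> * r / 2) = ennreal (\<delta> * r)"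
        using \<delta> r by (simp add: ennreal_plus[symmetric])
      also have "\<dots> \<le> emeasure lborel B" by (rule B)
      also have "\<dots> \<le> emeasure lborel (H \<union> (\<Union>\<alpha>\<in>S. ?b \<alpha>))"
        using H fin by (intro emeasure_mono sets.Un sets.finite_UN) (auto simp: H_def)
      also have "\<dots> \<le> emeasure lborel H + emeasure lborel (\<Union>\<alpha>\<in>S. ?b \<alpha>)"
        using H fin by (intro emeasure_subadditive sets.finite_UN) auto
      also have "emeasure lborel (\<Union>\<alpha>\<in>S. ?b \<alpha>) \<le> (\<Sum>\<alpha>\<in>S. emeasure lborel (?b \<alpha>))"
        using fin by (intro emeasure_subadditive_finite) auto
      also have "(\<Sum>\<alpha>\<in>S. emeasure lborel (?b \<alpha>)) = ennreal (real (card S) * (2 * s2 * r))"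
        using s2 r by (simp add: ennreal_of_nat_eq_real_of_nat ennreal_mult[symmetric] mult_ac)
      also have "\<dots> \<le> ennreal (real n * (2 * s2 * r))"
        using s2 r card by (intro ennreal_leI mult_right_mono) auto
      also have "real n * (2 * s2 * r) = \<delta> * r / 2" using n1 by (simp add: s2_def)
      finally have "ennreal (\<delta> * r / 2) + ennreal (\<delta> * r / 2) \<le> emeasure lborel H + ennreal (\<delta> * r / 2)"
        by (simp add: add_left_mono)
      then have Hm: "ennreal (\<delta> * r / 2) \<le> emeasure lborel H"
        unfolding add.commute[of "emeasure lborel H"] ennreal_add_left_cancel_le by simp
      have "ennreal \<kappa> = ennreal c2 * ennreal (\<delta> * r / 2)"
        unfolding \<kappa>_def using c2 \<delta> r by (intro ennreal_mult) auto
      also have "\<dots> \<le> ennreal c2 * emeasure lborel H" using Hm by (intro mult_left_mono) auto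
      also have "\<dots> = (\<integral>\<^sup>+y. ennreal c2 * indicator H y \<partial>lborel)"
        using H by (subst nn_integral_cmult_indicator) auto
      also have "\<dots> \<le> (\<integral>\<^sup>+y. ennreal (W t A y) * indicator B y \<partial>lborel)"
      proof (rule nn_integral_mono)
        fix y
        show "ennreal c2 * indicator H y \<le> ennreal (W t A y) * indicator B y"
        proof (cases "y \<in> H")
          case True
          then have y: "y \<in> B" "y \<in> B0" using B by (auto simp: H_def)
          have "V ^ n * k \<le> V ^ card S * k" using V card k by (intro mult_right_mono power_decreasing) auto
          also have "\<dots> = (\<Prod>\<alpha>\<in>S. V * level \<alpha> r)" by (simp add: k_def prod.distrib)
          also have "\<dots> \<le> W t S y" unfolding W_def
          proof (rule prod_mono)
            fix \<alpha> assume \<alpha>: "\<alpha> \<in> S"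
            then have "y \<notin> ?b \<alpha>" using True by (auto simp: H_def)
            then have "s2 * r \<le> \<bar>y - m \<alpha>\<bar>" unfolding atLeastAtMost_iff by linarith
            then show "0 \<le> V * level \<alpha> r \<and> V * level \<alpha> r \<le> h \<alpha> (t \<alpha>) y"
              using h_level_bounds(1)[of \<alpha> "t \<alpha>" r s2 y] near3[OF y(2) \<alpha>] lev[OF \<alpha>] \<alpha> fin t r s2 V
              by (auto simp: V_def)
          qed
          finally have "c2 \<le> W t S y * W t F y"
            unfolding c2_def using F_lower[OF y(2)] W_nonneg[OF fin(3) t] k V w0
            by (intro mult_mono) auto
          then show ?thesis using True y by (simp add: W_split ennreal_leI)
        qed simp
      qed
      also have "\<dots> = emeasure (N t A) B"
        unfolding N_def using B by (subst emeasure_density) auto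
      finally show ?thesis .
    qed
    ultimately show "\<exists>\<kappa>>0. emeasure (N t A) {x - r..x + r} \<le> ennreal (C * \<kappa>) \<and>
      (\<forall>B\<in>sets borel. B \<subseteq> {x - r..x + r} \<longrightarrow> ennreal (\<delta> * r) \<le> emeasure lborel B \<longrightarrow>
        ennreal \<kappa> \<le> emeasure (N t A) B)"
      using \<kappa> upper unfolding B0_def by (intro exI[of _ \<kappa>]) auto
  qed
qed

end

subsection \<open>The doubling measure\<close>

text \<open>A jump at \<open>z\<close> would be charged by doubling to an adjacent interval that
  avoids \<open>z\<close>. Quantitatively, the increment around \<open>z\<close> decays by the
  factor \<open>\<rho>\<close> whenever the radius is divided by \<open>5\<close>.\<close>

lemma mono_doubling_imp_continuous:
  fixes F :: "real \<Rightarrow> real"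
  assumes mono: "mono F" and "0 < C"
    and dbl: "\<And>x r. 0 < r \<Longrightarrow> F (x + 2 * r) - F (x - 2 * r) \<le> C * (F (x + r) - F (x - r))"
  shows "isCont F z"
proof -
  define D where "D s = F (z + s) - F (z - s)" for s
  define \<rho> where "\<rho> = C / (1 + C)"
  have \<rho>: "0 < \<rho>" "\<rho> < 1" using \<open>0 < C\<close> by (auto simp: \<rho>_def field_simps)
  have step: "D (s / 5) \<le> \<rho> * D s" if "0 < s" for s
  proof -
    \<comment> \<open>With centre \<open>z + 3 / 2 * r\<close>, the inner interval runs from
      \<open>z + s / 5\<close> to \<open>z + s\<close>, beside the small one around
      \<open>z\<close>, while the doubled interval starts at \<open>z - s / 5\<close> and covers the
      small one.\<close>
    define r where "r = 2 * s / 5"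
    have "D (s / 5) \<le> F (z + 3 / 2 * r + 2 * r) - F (z + 3 / 2 * r - 2 * r)"
    proof -
      have "F (z + s / 5) \<le> F (z + 3 / 2 * r + 2 * r)"
        by (rule monoD[OF mono]) (use that in \<open>simp add: r_def\<close>)
      moreover have "z + 3 / 2 * r - 2 * r = z - s / 5" by (simp add: r_def)
      ultimately show ?thesis unfolding D_def by (simp only: diff_right_mono)
    qed
    also have "\<dots> \<le> C * (F (z + 3 / 2 * r + r) - F (z + 3 / 2 * r - r))"
      using that by (intro dbl) (simp add: r_def)
    also have "z + 3 / 2 * r + r = z + s" by (simp add: r_def)
    also have "z + 3 / 2 * r - r = z + s / 5" by (simp add: r_def)
    also have "C * (F (z + s) - F (z + s / 5)) \<le> C * (D s - D (s / 5))"
      unfolding D_def using that \<open>0 < C\<close> monoD[OF mono, of "z - s" "z - s / 5"]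
      by (intro mult_left_mono) auto
    finally show ?thesis using \<open>0 < C\<close> by (simp add: \<rho>_def field_simps)
  qed
  have iter: "D (1 / 5 ^ k) \<le> \<rho> ^ k * D 1" for k
  proof (induction k)
    case (Suc k)
    have "D (1 / 5 ^ Suc k) = D (1 / 5 ^ k / 5)" by (simp add: mult.commute)
    also have "\<dots> \<le> \<rho> * D (1 / 5 ^ k)" by (rule step) simp
    also have "\<dots> \<le> \<rho> * (\<rho> ^ k * D 1)" using Suc \<rho> by (intro mult_left_mono) auto
    finally show ?case by simp
  qed simp
  have "(\<lambda>k. \<rho> ^ k * D 1) \<longlonglongrightarrow> 0 * D 1"
    using \<rho> by (intro tendsto_mult LIMSEQ_power_zero tendsto_const) auto
  then have lim: "(\<lambda>k. \<rho> ^ k * D 1) \<longlonglongrightarrow> 0" by simp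
  show ?thesis
  proof (rule continuous_at_eps_delta[THEN iffD2], intro allI impI)
    fix e :: real assume "0 < e"
    then have "eventually (\<lambda>k. \<rho> ^ k * D 1 < e) sequentially" using order_tendstoD(2)[OF lim] by blast
    then obtain k where k: "\<rho> ^ k * D 1 < e" by (auto simp: eventually_sequentially)
    define s :: real where "s = 1 / 5 ^ k"
    have s: "0 < s" "D s < e" using iter[of k] k by (auto simp: s_def)
    show "\<exists>d>0. \<forall>x. dist x z < d \<longrightarrow> dist (F x) (F z) < e"
    proof (intro exI[of _ s] conjI allI impI)
      fix x assume "dist x z < s"
      then have "z - s \<le> x" "x \<le> z + s" by (auto simp: dist_real_def abs_less_iff)
      then have "F (z - s) \<le> F x" "F x \<le> F (z + s)" "F (z - s) \<le> F z" "F z \<le> F (z + s)"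
        using s by (auto intro!: monoD[OF mono])
      then show "dist (F x) (F z) < e" using s by (auto simp: D_def dist_real_def)
    qed (rule s)
  qed
qed

lemma emeasure_interval_measure_continuous:
  fixes F :: "real \<Rightarrow> real"
  assumes "mono F" "\<And>x. isCont F x" "a \<le> b"
  shows "emeasure (interval_measure F) {a..b} = ennreal (F b - F a)"
    "emeasure (interval_measure F) {a<..<b} = ennreal (F b - F a)"
proof -
  have cont: "continuous_on UNIV F" using assms(2) by (simp add: continuous_on_eq_continuous_at)
  have mono: "\<And>x y. x \<le> y \<Longrightarrow> F x \<le> F y" using \<open>mono F\<close> by (auto dest: monoD)
  have Icc: "emeasure (interval_measure F) {a..b} = ennreal (F b - F a)" if "a \<le> b" for a b
    using emeasure_interval_measure_Icc[of a b F] mono cont that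
    by (simp add: continuous_on_subset)
  show "emeasure (interval_measure F) {a..b} = ennreal (F b - F a)" using Icc assms by blast
  show "emeasure (interval_measure F) {a<..<b} = ennreal (F b - F a)"
  proof (cases "a < b")
    case True
    have "{a..b} = {a<..<b} \<union> {a..a} \<union> {b..b}" using True by auto
    moreover have "emeasure (interval_measure F) ({a<..<b} \<union> {a..a} \<union> {b..b}) =
        emeasure (interval_measure F) ({a<..<b} \<union> {a..a})"
      using Icc[of b b] by (intro emeasure_Un_null_set null_setsI) auto
    moreover have "\<dots> = emeasure (interval_measure F) {a<..<b}"
      using Icc[of a a] by (intro emeasure_Un_null_set null_setsI) auto
    ultimately show ?thesis using Icc[of a b] True by simp
  qed (use assms in simp)
qed

context interval_tree
begin

section \<open>Stability of masses when smaller intervals are added\<close>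

definition tau :: "'a \<Rightarrow> real" where
  "tau = (SOME t. \<forall>\<alpha>. \<bar>t \<alpha>\<bar> \<le> 1 / 2 \<and> (\<alpha> \<in> At \<longrightarrow>
    (\<integral>\<^sup>+y. ennreal (h \<alpha> (t \<alpha>) y * W t (anc \<alpha>) y) * indicator (zone \<alpha>) y \<partial>lborel) =
    (\<integral>\<^sup>+y. ennreal (W t (anc \<alpha>) y) * indicator (zone \<alpha>) y \<partial>lborel)))"

lemma tau:
  shows tau_le: "\<bar>tau \<alpha>\<bar> \<le> 1 / 2"
    and tau_preserves: "\<alpha> \<in> At \<Longrightarrow>
      (\<integral>\<^sup>+y. ennreal (h \<alpha> (tau \<alpha>) y * W tau (anc \<alpha>) y) * indicator (zone \<alpha>) y \<partial>lborel) =
      (\<integral>\<^sup>+y. ennreal (W tau (anc \<alpha>) y) * indicator (zone \<alpha>) y \<partial>lborel)"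
  using someI_ex[OF exists_mass_preserving_family, folded tau_def] by blast+

lemma sets_N [simp, measurable_cong]: "sets (N t A) = sets borel"
  by (simp add: N_def)

lemma emeasure_N:
  "B \<in> sets borel \<Longrightarrow> emeasure (N t A) B = (\<integral>\<^sup>+y. ennreal (W t A y) * indicator B y \<partial>lborel)"
  unfolding N_def by (subst emeasure_density) auto

lemma zone_inside:
  assumes "\<alpha> \<in> At" "y \<in> zone \<alpha>"
  shows "lo \<alpha> < y" "y < hi \<alpha>"
  using m_ends[of \<alpha>] gL_pos[of \<alpha>] assms by (auto simp: zone_def)

text \<open>A weight different from \<open>1\<close> somewhere on the interval of
  \<open>\<alpha>\<close> belongs to an interval that overlaps it: an ancestor,
  \<open>\<alpha>\<close> itself or something below \<open>\<alpha>\<close>, and the last is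
  excluded.\<close>

lemma W_on_interval:
  assumes A: "finite A" "A \<subseteq> At" "anc \<alpha> \<subseteq> A" and \<alpha>: "\<alpha> \<in> At" and nb: "\<And>\<beta>. \<beta> \<in> A \<Longrightarrow> \<not> below \<beta> \<alpha>"
    and y: "lo \<alpha> \<le> y" "y \<le> hi \<alpha>"
  shows "W t A y = (if \<alpha> \<in> A then h \<alpha> (t \<alpha>) y else 1) * W t (anc \<alpha>) y"
proof -
  have "W t A y = (\<Prod>\<beta>\<in>anc \<alpha> \<union> ({\<alpha>} \<inter> A). h \<beta> (t \<beta>) y)" unfolding W_def
  proof (rule prod.mono_neutral_right)
    show "\<forall>\<beta>\<in>A - (anc \<alpha> \<union> ({\<alpha>} \<inter> A)). h \<beta> (t \<beta>) y = 1"
    proof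
      fix \<beta> assume \<beta>: "\<beta> \<in> A - (anc \<alpha> \<union> ({\<alpha>} \<inter> A))"
      have "y \<notin> zone \<beta>"
      proof
        assume "y \<in> zone \<beta>"
        then have "lo \<beta> < y" "y < hi \<beta>" using zone_inside \<beta> A by auto
        then have "below \<alpha> \<beta> \<or> below \<beta> \<alpha>"
          using y \<beta> A \<alpha> by (intro overlap_nested) auto
        then show False using nb \<beta> A by (auto simp: anc_def)
      qed
      then show "h \<beta> (t \<beta>) y = 1" using \<beta> A by (intro h_eq_1) (auto simp: zone_iff)
    qed
  qed (use A in auto)
  moreover have "\<alpha> \<notin> anc \<alpha>" by (simp add: anc_def below_def)
  moreover have "finite (anc \<alpha>)" using finite_anc \<alpha> by blast
  ultimately show ?thesis by (auto simp: W_def Int_insert_left)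
qed

text \<open>The new weight acts only on its zone, where the old density is the product over the
  ancestors, and \<open>tau\<close> was chosen to keep the mass of the zone. So only sets that cut
  the zone can notice it.\<close>

lemma N_insert:
  assumes A: "finite A" "A \<subseteq> At" "anc \<alpha> \<subseteq> A" and \<alpha>: "\<alpha> \<in> At" "\<alpha> \<notin> A"
    and nb: "\<And>\<beta>. \<beta> \<in> A \<Longrightarrow> \<not> below \<beta> \<alpha>"
    and T: "T \<in> sets borel" "zone \<alpha> \<subseteq> T \<or> zone \<alpha> \<inter> T = {}"
  shows "emeasure (N tau (insert \<alpha> A)) T = emeasure (N tau A) T"
proof -
  have W: "W tau (insert \<alpha> A) y = h \<alpha> (tau \<alpha>) y * W tau A y" for y
    using A \<alpha> by (simp add: W_def)
  have off: "emeasure (N tau (insert \<alpha> A)) B = emeasure (N tau A) B"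
    if "B \<in> sets borel" "zone \<alpha> \<inter> B = {}" for B
  proof -
    have "ennreal (W tau (insert \<alpha> A) y) * indicator B y = ennreal (W tau A y) * indicator B y" for y
    proof (cases "y \<in> B")
      case True
      then have "y \<notin> zone \<alpha>" using that by blast
      then have "h \<alpha> (tau \<alpha>) y = 1" using \<alpha> by (intro h_eq_1) (auto simp: zone_iff)
      then show ?thesis by (simp add: W)
    qed simp
    then show ?thesis using that by (simp add: emeasure_N)
  qed
  have Wz: "W tau A y = W tau (anc \<alpha>) y" if "y \<in> zone \<alpha>" for y
    using W_on_interval[OF A \<alpha>(1) nb, of y] zone_inside[OF \<alpha>(1) that] \<alpha> by simp
  have on: "emeasure (N tau (insert \<alpha> A)) (zone \<alpha>) = emeasure (N tau A) (zone \<alpha>)"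
  proof -
    have "ennreal (W tau (insert \<alpha> A) y) * indicator (zone \<alpha>) y =
        ennreal (h \<alpha> (tau \<alpha>) y * W tau (anc \<alpha>) y) * indicator (zone \<alpha>) y"
      "ennreal (W tau A y) * indicator (zone \<alpha>) y = ennreal (W tau (anc \<alpha>) y) * indicator (zone \<alpha>) y" for y
      using Wz by (auto simp: W indicator_def)
    then show ?thesis using tau_preserves[OF \<alpha>(1)] by (simp add: emeasure_N)
  qed
  show ?thesis
  proof (cases "zone \<alpha> \<inter> T = {}")
    case False
    then have T_eq: "T = zone \<alpha> \<union> (T - zone \<alpha>)" using T by blast
    have "emeasure (N tau B) T = emeasure (N tau B) (zone \<alpha>) + emeasure (N tau B) (T - zone \<alpha>)" for B
      using T by (subst T_eq, intro plus_emeasure[symmetric]) auto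
    then show ?thesis using on off[of "T - zone \<alpha>"] T by auto
  qed (use off T in auto)
qed

text \<open>Each \<open>tau \<alpha>\<close> is normalised against the product over all of
  \<open>anc \<alpha>\<close>, so preservation of mass is available only for families that contain
  all ancestors.\<close>

definition up_closed :: "'a set \<Rightarrow> bool" where
  "up_closed A \<longleftrightarrow> finite A \<and> A \<subseteq> At \<and> (\<forall>\<alpha>\<in>A. anc \<alpha> \<subseteq> A)"

lemma N_eq_if_up_closed:
  assumes "up_closed A" "up_closed B" "A \<subseteq> B" "T \<in> sets borel"
    and "\<And>\<alpha>. \<alpha> \<in> B - A \<Longrightarrow> zone \<alpha> \<subseteq> T \<or> zone \<alpha> \<inter> T = {}"
  shows "emeasure (N tau B) T = emeasure (N tau A) T"
  using assms(2,3,5)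
proof (induction "card (B - A)" arbitrary: B)
  case 0
  then have "B - A = {}" by (simp add: up_closed_def)
  then have "B = A" using 0 by blast
  then show ?case by simp
next
  case (Suc n)
  have fin: "finite (B - A)" "B - A \<noteq> {}" using Suc by (auto simp: up_closed_def)
  \<comment> \<open>A shortest new interval is removed. Nothing new lies below it by minimality, and
    nothing of \<open>A\<close> does, since \<open>A\<close> would then contain it as an ancestor;
    so the rest remains closed upwards.\<close>
  define \<alpha> where "\<alpha> = arg_min_on L (B - A)"
  have \<alpha>: "\<alpha> \<in> B - A" unfolding \<alpha>_def using fin by (rule arg_min_if_finite(1))
  have min: "L \<alpha> \<le> L \<beta>" if "\<beta> \<in> B - A" for \<beta>
    unfolding \<alpha>_def using arg_min_least[OF fin that] .
  have nb: "\<not> below \<beta> \<alpha>" if \<beta>: "\<beta> \<in> B" for \<beta>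
  proof
    assume *: "below \<beta> \<alpha>"
    have At: "\<alpha> \<in> At" "\<beta> \<in> At" using \<alpha> \<beta> Suc by (auto simp: up_closed_def)
    show False
    proof (cases "\<beta> \<in> A")
      case True
      then have "\<alpha> \<in> A" using * At assms(1) by (auto simp: up_closed_def anc_def)
      then show False using \<alpha> by simp
    next
      case False
      then show False using min[of \<beta>] below_L_less[of \<beta> \<alpha>] * At \<beta> by auto
    qed
  qed
  have closed: "up_closed (B - {\<alpha>})"
    using Suc.prems(1) nb by (auto simp: up_closed_def anc_def)
  have "emeasure (N tau (B - {\<alpha>})) T = emeasure (N tau A) T"
  proof (rule Suc.hyps(1))
    have "B - {\<alpha>} - A = (B - A) - {\<alpha>}" by blast
    then show "n = card (B - {\<alpha>} - A)" using Suc.hyps(2) \<alpha> fin by simp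
  qed (use closed Suc.prems \<alpha> in auto)
  moreover have "emeasure (N tau (insert \<alpha> (B - {\<alpha>}))) T = emeasure (N tau (B - {\<alpha>})) T"
  proof (rule N_insert)
    show "anc \<alpha> \<subseteq> B - {\<alpha>}" using \<alpha> Suc.prems(1) by (auto simp: up_closed_def anc_def below_def)
  qed (use closed \<alpha> Suc.prems nb assms in \<open>auto simp: up_closed_def\<close>)
  moreover have "insert \<alpha> (B - {\<alpha>}) = B" using \<alpha> by blast
  ultimately show ?case by simp
qed

section \<open>Truncation by length and saturated points\<close>

definition big :: "real \<Rightarrow> 'a set" where "big e = {\<alpha>\<in>At. e < L \<alpha>}"

lemma big_up_closed:
  assumes "0 < e"
  shows "up_closed (big e)"
proof -
  have "finite (big e)" by (rule finite_subset[OF _ finite_large[OF assms]]) (auto simp: big_def)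
  moreover have "anc \<alpha> \<subseteq> big e" if "\<alpha> \<in> big e" for \<alpha>
    using that below_L_less[of \<alpha>] by (force simp: big_def anc_def)
  ultimately show ?thesis by (auto simp: up_closed_def big_def)
qed

text \<open>Intervals outside \<open>big e\<close> do not straddle such a point, so each of them
  lies on one side of it. The mass between two saturated points is therefore final at scale
  \<open>e\<close>.\<close>

definition saturated :: "real \<Rightarrow> real \<Rightarrow> bool" where
  "saturated e x \<longleftrightarrow> (\<forall>\<alpha>\<in>At. L \<alpha> \<le> e \<longrightarrow> \<not> (lo \<alpha> < x \<and> x < hi \<alpha>))"

lemma saturated_outside: "x \<le> - R \<or> R \<le> x \<Longrightarrow> saturated e x"
  using bounded_At by (force simp: saturated_def)

lemma N_big_eq:
  assumes "0 < d" "d \<le> e" "saturated e u" "saturated e v"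
  shows "emeasure (N tau (big d)) {u<..v} = emeasure (N tau (big e)) {u<..v}"
proof (rule N_eq_if_up_closed)
  fix \<alpha> assume \<alpha>: "\<alpha> \<in> big d - big e"
  then have "u \<le> lo \<alpha> \<or> hi \<alpha> \<le> u" "v \<le> lo \<alpha> \<or> hi \<alpha> \<le> v" "\<alpha> \<in> At"
    using assms(3,4) by (force simp: big_def saturated_def)+
  then show "zone \<alpha> \<subseteq> {u<..v} \<or> zone \<alpha> \<inter> {u<..v} = {}"
    using zone_inside[of \<alpha>] lo_less_hi[of \<alpha>] by fastforce
qed (use assms big_up_closed in \<open>auto simp: big_def\<close>)

text \<open>A longest interval of length at most \<open>e\<close> around \<open>x\<close> has
  saturated ends: another admissible interval around one of these ends would contain it and be
  longer. Hence saturated points occur within distance \<open>e\<close> of every point.\<close>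

lemma saturated_hull:
  assumes "\<not> saturated e x"
  obtains \<alpha> where "\<alpha> \<in> At" "L \<alpha> \<le> e" "lo \<alpha> < x" "x < hi \<alpha>" "saturated e (lo \<alpha>)" "saturated e (hi \<alpha>)"
proof -
  obtain \<alpha>0 where \<alpha>0: "\<alpha>0 \<in> At" "L \<alpha>0 \<le> e" "lo \<alpha>0 < x" "x < hi \<alpha>0"
    using assms by (auto simp: saturated_def)
  \<comment> \<open>The lower bound \<open>L \<alpha>0\<close> on the length makes the set finite,
    so that a longest element exists.\<close>
  define Q where "Q = {\<alpha>\<in>At. L \<alpha> \<le> e \<and> lo \<alpha> < x \<and> x < hi \<alpha> \<and> L \<alpha>0 \<le> L \<alpha>}"
  have fin: "finite Q"
    by (rule finite_subset[OF _ finite_large[OF L_pos[OF \<alpha>0(1)]]]) (auto simp: Q_def)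
  have "\<alpha>0 \<in> Q" using \<alpha>0 by (simp add: Q_def)
  then have ne: "Q \<noteq> {}" by blast
  define \<alpha> where "\<alpha> = arg_min_on (\<lambda>\<beta>. - L \<beta>) Q"
  have \<alpha>: "\<alpha> \<in> Q" unfolding \<alpha>_def using fin ne by (rule arg_min_if_finite(1))
  have max: "L \<beta> \<le> L \<alpha>" if "\<beta> \<in> Q" for \<beta>
    using arg_min_least[OF fin ne that, of "\<lambda>\<beta>. - L \<beta>"] by (simp add: \<alpha>_def)
  have \<alpha>At: "\<alpha> \<in> At" using \<alpha> by (simp add: Q_def)
  have *: False if \<beta>: "\<beta> \<in> At" "L \<beta> \<le> e" "lo \<beta> < z" "z < hi \<beta>" "z = lo \<alpha> \<or> z = hi \<alpha>" for \<beta> z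
  proof -
    have "\<alpha> \<noteq> \<beta>" using \<beta> by auto
    moreover have "lo \<alpha> < hi \<beta>" "lo \<beta> < hi \<alpha>" using \<beta> lo_less_hi[OF \<alpha>At] by auto
    ultimately have "below \<alpha> \<beta>"
      using overlap_nested[of \<alpha> \<beta>] \<alpha>At \<beta> by (auto simp: below_def)
    then have "\<beta> \<in> Q" "L \<alpha> < L \<beta>"
      using \<alpha> \<beta> below_L_less[of \<alpha> \<beta>] by (auto simp: Q_def below_def)
    then show False using max[of \<beta>] by simp
  qed
  then have "saturated e (lo \<alpha>)" "saturated e (hi \<alpha>)" by (auto simp: saturated_def)
  then show ?thesis using that \<alpha> by (auto simp: Q_def)
qed

lemma saturated_left:
  assumes "0 < e"
  obtains z where "saturated e z" "x - e \<le> z" "z \<le> x"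
proof (cases "saturated e x")
  case False
  then obtain \<alpha> where "\<alpha> \<in> At" "L \<alpha> \<le> e" "lo \<alpha> < x" "x < hi \<alpha>" "saturated e (lo \<alpha>)"
    by (rule saturated_hull)
  then show ?thesis by (intro that[of "lo \<alpha>"]) (auto simp: L_def)
qed (use that[of x] assms in auto)

lemma saturated_right:
  assumes "0 < e"
  obtains z where "saturated e z" "x \<le> z" "z \<le> x + e"
proof (cases "saturated e x")
  case False
  then obtain \<alpha> where "\<alpha> \<in> At" "L \<alpha> \<le> e" "lo \<alpha> < x" "x < hi \<alpha>" "saturated e (hi \<alpha>)"
    by (rule saturated_hull)
  then show ?thesis by (intro that[of "hi \<alpha>"]) (auto simp: L_def)
qed (use that[of x] assms in auto)

lemma N_big_comparison:
  assumes "0 < \<delta>" "\<delta> \<le> 1"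
  shows "\<exists>C>0. \<forall>e x r. 0 < e \<longrightarrow> 0 < r \<longrightarrow> \<delta> * r \<le> e \<longrightarrow>
    (\<exists>\<kappa>>0. emeasure (N tau (big e)) {x - r..x + r} \<le> ennreal (C * \<kappa>) \<and>
      (\<forall>B\<in>sets borel. B \<subseteq> {x - r..x + r} \<longrightarrow> ennreal (\<delta> * r) \<le> emeasure lborel B \<longrightarrow>
        ennreal \<kappa> \<le> emeasure (N tau (big e)) B))"
proof -
  have big: "finite (big e) \<and> big e \<subseteq> At" "\<forall>\<alpha>\<in>big e. d \<le> L \<alpha>" if "0 < e" "d \<le> e" for d e
    using big_up_closed[OF that(1)] that by (auto simp: up_closed_def big_def)
  obtain C where C: "0 < C" and N: "\<forall>t A x r. (\<forall>\<alpha>. \<bar>t \<alpha>\<bar> \<le> 1 / 2) \<longrightarrow> finite A \<and> A \<subseteq> At \<longrightarrow> 0 < r \<longrightarrow>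
    (\<forall>\<alpha>\<in>A. \<delta> * r \<le> L \<alpha>) \<longrightarrow> (\<exists>\<kappa>>0. emeasure (N t A) {x - r..x + r} \<le> ennreal (C * \<kappa>) \<and>
      (\<forall>B\<in>sets borel. B \<subseteq> {x - r..x + r} \<longrightarrow> ennreal (\<delta> * r) \<le> emeasure lborel B \<longrightarrow>
        ennreal \<kappa> \<le> emeasure (N t A) B))"
    using N_ball_comparison[OF assms] by (elim exE conjE)
  show ?thesis
    by (intro exI[of _ C] conjI C allI impI N[THEN spec, THEN spec, THEN spec, THEN spec, THEN mp, THEN mp, THEN mp, THEN mp] tau_le)
      (use big in auto)
qed

text \<open>For \<open>p < 1\<close> the weights are unbounded, so finiteness is taken from the
  comparison of masses, with \<open>\<delta>\<close> shrunk until \<open>\<delta> * r\<close> \<le>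
  \<open>e\<close>.\<close>

lemma N_big_finite:
  assumes "0 < e"
  shows "emeasure (N tau (big e)) {u<..v} < \<infinity>"
proof (cases "u < v")
  case True
  define r where "r = (v - u) / 2"
  have r: "0 < r" using True by (simp add: r_def)
  define \<delta> where "\<delta> = min 1 (e / r)"
  have \<delta>: "0 < \<delta>" "\<delta> \<le> 1" using r assms by (auto simp: \<delta>_def)
  obtain C where "\<And>e x r. 0 < e \<Longrightarrow> 0 < r \<Longrightarrow> \<delta> * r \<le> e \<Longrightarrow>
      \<exists>\<kappa>>0. emeasure (N tau (big e)) {x - r..x + r} \<le> ennreal (C * \<kappa>)"
    using N_big_comparison[OF \<delta>] by meson
  moreover have "\<delta> * r \<le> e / r * r" unfolding \<delta>_def using r by (intro mult_right_mono) auto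
  ultimately have "\<exists>\<kappa>>0. emeasure (N tau (big e)) {(u + v) / 2 - r..(u + v) / 2 + r} \<le> ennreal (C * \<kappa>)"
    using r assms by simp
  then obtain \<kappa> where "emeasure (N tau (big e)) {(u + v) / 2 - r..(u + v) / 2 + r} \<le> ennreal (C * \<kappa>)" by blast
  moreover have "emeasure (N tau (big e)) {u<..v} \<le> emeasure (N tau (big e)) {(u + v) / 2 - r..(u + v) / 2 + r}"
    by (intro emeasure_mono) (auto simp: r_def field_simps)
  ultimately show ?thesis by (metis ennreal_less_top infinity_ennreal_def le_less_trans)
qed simp

section \<open>The distribution function and its doubling property\<close>

definition G :: "real \<Rightarrow> real \<Rightarrow> real" where
  "G e x = (if - R \<le> x then Sigma_Algebra.measure (N tau (big e)) {- R<..x}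
     else - Sigma_Algebra.measure (N tau (big e)) {x<..- R})"

lemma G_diff:
  assumes "0 < e" "u \<le> v"
  shows "G e v - G e u = Sigma_Algebra.measure (N tau (big e)) {u<..v}"
proof -
  have add: "Sigma_Algebra.measure (N tau (big e)) {x<..z} =
      Sigma_Algebra.measure (N tau (big e)) {x<..y} + Sigma_Algebra.measure (N tau (big e)) {y<..z}"
    if "x \<le> y" "y \<le> z" for x y z
  proof -
    have "{x<..z} = {x<..y} \<union> {y<..z}" using that by auto
    then show ?thesis
      using N_big_finite[OF assms(1)] by (simp add: measure_Union less_top[symmetric] less_imp_neq)
  qed
  show ?thesis
    using add[of "- R" u v] add[of u "- R" v] add[of u v "- R"] assms by (auto simp: G_def)
qed

text \<open>The base point \<open>- R\<close> is saturated at every scale, so \<open>G\<close> at a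
  saturated point is, up to sign, a mass between two saturated points.\<close>

lemma G_saturated:
  assumes "0 < d" "d \<le> e" "saturated e z"
  shows "G d z = G e z"
  using N_big_eq[OF assms(1,2), of "- R" z] N_big_eq[OF assms(1,2), of z "- R"] assms saturated_outside[of "- R" e]
  by (auto simp: G_def Sigma_Algebra.measure_def)

text \<open>The distribution function is prescribed at the saturated points. Doubling and hence continuity
  already follow from these values, so any monotone extension will do and no limit of the
  approximating measures is needed.\<close>

definition F :: "real \<Rightarrow> real" where
  "F x = Sup {G e z | e z. 0 < e \<and> saturated e z \<and> z \<le> x}"

text \<open>Both values survive the passage to the finer of the two scales, where they belong to one
  measure.\<close>

lemma G_mono_saturated:
  assumes "0 < e" "saturated e z" "0 < e'" "saturated e' z'" "z \<le> z'"
  shows "G e z \<le> G e' z'"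
proof -
  define d where "d = min e e'"
  have "G d z = G e z" "G d z' = G e' z'" using assms by (auto simp: d_def intro!: G_saturated)
  moreover have "0 \<le> G d z' - G d z" using assms by (subst G_diff) (auto simp: d_def)
  ultimately show ?thesis by simp
qed

lemma F_saturated:
  assumes "0 < e" "saturated e z"
  shows "F z = G e z"
  unfolding F_def using assms G_mono_saturated by (intro cSup_eq_maximum) blast+

lemma F_mono: "mono F"
proof (rule monoI)
  fix x y :: real assume "x \<le> y"
  show "F x \<le> F y" unfolding F_def
  proof (rule cSup_subset_mono)
    have "saturated 1 (min x (- R))" by (rule saturated_outside) simp
    then show "{G e z |e z. 0 < e \<and> saturated e z \<and> z \<le> x} \<noteq> {}"
      using min.cobounded1[of x "- R"] zero_less_one by blast
    have "saturated 1 (max y R)" by (rule saturated_outside) simp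
    then show "bdd_above {G e z |e z. 0 < e \<and> saturated e z \<and> z \<le> y}"
      by (intro bdd_aboveI[of _ "G 1 (max y R)"]) (auto intro!: G_mono_saturated)
  qed (use \<open>x \<le> y\<close> order_trans in blast)
qed

lemma F_diff:
  assumes "0 < e" "saturated e u" "saturated e v" "u \<le> v"
  shows "ennreal (F v - F u) = emeasure (N tau (big e)) {u<..v}"
proof -
  have "emeasure (N tau (big e)) {u<..v} = ennreal (Sigma_Algebra.measure (N tau (big e)) {u<..v})"
    using N_big_finite[OF assms(1), of u v] by (intro emeasure_eq_ennreal_measure) auto
  then show ?thesis using F_saturated assms G_diff by metis
qed

lemma F_doubling:
  obtains C where "0 < C"
    "\<And>x r. 0 < r \<Longrightarrow> F (x + 2 * r) - F (x - 2 * r) \<le> C * (F (x + r) - F (x - r))"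
    "\<And>x r. 0 < r \<Longrightarrow> F (x - r) < F (x + r)"
proof -
  obtain C where C: "0 < C" "\<And>e x r. 0 < e \<Longrightarrow> 0 < r \<Longrightarrow> 1 / 12 * r \<le> e \<Longrightarrow>
    \<exists>\<kappa>>0. emeasure (N tau (big e)) {x - r..x + r} \<le> ennreal (C * \<kappa>) \<and>
      (\<forall>B\<in>sets borel. B \<subseteq> {x - r..x + r} \<longrightarrow> ennreal (1 / 12 * r) \<le> emeasure lborel B \<longrightarrow>
        ennreal \<kappa> \<le> emeasure (N tau (big e)) B)"
    using N_big_comparison[of "1 / 12"] by auto
  have main: "F (x + 2 * r) - F (x - 2 * r) \<le> C * (F (x + r) - F (x - r)) \<and> F (x - r) < F (x + r)"
    if r: "0 < r" for x r
  proof -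
    \<comment> \<open>With \<open>e = r / 4\<close>, the points \<open>z1\<close>, \<open>z2\<close>
      remain within \<open>3 * r\<close> of \<open>x\<close> and \<open>z3\<close>,
      \<open>z4\<close> within \<open>r\<close>. The constant \<open>1 / 12\<close> is chosen so
      that \<open>1 / 12 * (3 * r) = e\<close>.\<close>
    define e where "e = r / 4"
    have e: "0 < e" using r by (simp add: e_def)
    obtain z1 where z1: "saturated e z1" "x - 2 * r - e \<le> z1" "z1 \<le> x - 2 * r" using saturated_left[OF e] .
    obtain z2 where z2: "saturated e z2" "x + 2 * r \<le> z2" "z2 \<le> x + 2 * r + e" using saturated_right[OF e] .
    obtain z3 where z3: "saturated e z3" "x - r / 2 - e \<le> z3" "z3 \<le> x - r / 2" using saturated_left[OF e] .
    obtain z4 where z4: "saturated e z4" "x + r / 2 \<le> z4" "z4 \<le> x + r / 2 + e" using saturated_right[OF e] .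
    note z = z1 z2 z3 z4
    have "\<exists>\<kappa>>0. emeasure (N tau (big e)) {x - 3 * r..x + 3 * r} \<le> ennreal (C * \<kappa>) \<and>
      (\<forall>B\<in>sets borel. B \<subseteq> {x - 3 * r..x + 3 * r} \<longrightarrow> ennreal (1 / 12 * (3 * r)) \<le> emeasure lborel B \<longrightarrow>
        ennreal \<kappa> \<le> emeasure (N tau (big e)) B)"
      by (rule C(2)) (use r in \<open>auto simp: e_def\<close>)
    then obtain \<kappa> where \<kappa>: "0 < \<kappa>" "emeasure (N tau (big e)) {x - 3 * r..x + 3 * r} \<le> ennreal (C * \<kappa>)"
      "\<And>B. B \<in> sets borel \<Longrightarrow> B \<subseteq> {x - 3 * r..x + 3 * r} \<Longrightarrow> ennreal (1 / 12 * (3 * r)) \<le> emeasure lborel B \<Longrightarrow>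
        ennreal \<kappa> \<le> emeasure (N tau (big e)) B" by blast
    have "ennreal (F z2 - F z1) = emeasure (N tau (big e)) {z1<..z2}"
      using z e r by (intro F_diff) auto
    also have "\<dots> \<le> emeasure (N tau (big e)) {x - 3 * r..x + 3 * r}"
      using z r by (intro emeasure_mono) (auto simp: e_def)
    also note \<kappa>(2)
    finally have up: "F z2 - F z1 \<le> C * \<kappa>" using C(1) \<kappa>(1) by (subst (asm) ennreal_le_iff) auto
    have "ennreal \<kappa> \<le> emeasure (N tau (big e)) {z3<..z4}"
      using z r by (intro \<kappa>(3)) (auto simp: e_def intro!: ennreal_leI)
    also have "\<dots> = ennreal (F z4 - F z3)"
      using z e r by (intro F_diff[symmetric]) auto
    finally have low: "\<kappa> \<le> F z4 - F z3"
      using \<kappa>(1) by (metis ennreal_le_iff2 not_less)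
    have "F z4 - F z3 \<le> F (x + r) - F (x - r)"
      using z r by (intro diff_mono monoD[OF F_mono]) (auto simp: e_def)
    then have low': "\<kappa> \<le> F (x + r) - F (x - r)" using low by simp
    have "F (x + 2 * r) - F (x - 2 * r) \<le> F z2 - F z1"
      using z by (intro diff_mono monoD[OF F_mono]) auto
    also have "\<dots> \<le> C * \<kappa>" by (rule up)
    also have "\<dots> \<le> C * (F (x + r) - F (x - r))" using low' C(1) by (intro mult_left_mono) auto
    finally show ?thesis using low' \<kappa>(1) by auto
  qed
  show ?thesis using that[OF C(1)] main by blast
qed

lemma F_continuous: "isCont F x"
  using F_doubling mono_doubling_imp_continuous[OF F_mono] by metis

lemma doubling_interval_measure_F: "doubling_measure (interval_measure F)"
proof -
  obtain C where C: "0 < C"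
    "\<And>x r. 0 < r \<Longrightarrow> F (x + 2 * r) - F (x - 2 * r) \<le> C * (F (x + r) - F (x - r))"
    "\<And>x r. 0 < r \<Longrightarrow> F (x - r) < F (x + r)"
    using F_doubling by metis
  have ball: "emeasure (interval_measure F) (ball x r) = ennreal (F (x + r) - F (x - r))" if "0 < r" for x r
    using emeasure_interval_measure_continuous(2)[OF F_mono F_continuous, of "x - r" "x + r"] that
    by (simp add: ball_eq_greaterThanLessThan)
  show ?thesis unfolding doubling_measure_def
  proof (intro conjI exI[of _ C] allI impI)
    fix x r :: real assume r: "0 < r"
    show "0 < emeasure (interval_measure F) (ball x (2 * r))"
      using C(3)[of "2 * r" x] r by (simp add: ball)
    show "emeasure (interval_measure F) (ball x (2 * r)) \<le> ennreal C * emeasure (interval_measure F) (ball x r)"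
      using C(1) C(2)[OF r, of x] C(3)[OF r, of x] r by (simp add: ball ennreal_mult[symmetric] ennreal_leI)
    show "emeasure (interval_measure F) (ball x r) < \<infinity>" using r by (simp add: ball)
  qed simp
qed

end

subsection \<open>Gap ratios\<close>

context interval_tree
begin

text \<open>At scale \<open>(1 - g) * L \<alpha>\<close> the family \<open>big\<close> contains
  \<open>\<alpha>\<close> and its ancestors but nothing below \<open>\<alpha>\<close>. So the masses
  of the interval and of its gap can both be computed from one finite product.\<close>

lemma saturated_endpoints:
  assumes \<alpha>: "\<alpha> \<in> At" and gap: "\<And>\<beta>. \<beta> \<in> At \<Longrightarrow> below \<beta> \<alpha> \<Longrightarrow> hi \<beta> \<le> c \<or> d \<le> lo \<beta>"
    and cd: "lo \<alpha> \<le> c" "c < d" "d \<le> hi \<alpha>" and z: "z \<in> {lo \<alpha>, hi \<alpha>, c, d}"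
  shows "saturated ((1 - g) * L \<alpha>) z"
  unfolding saturated_def
proof (intro ballI impI notI)
  fix \<beta> assume \<beta>: "\<beta> \<in> At" "L \<beta> \<le> (1 - g) * L \<alpha>" "lo \<beta> < z \<and> z < hi \<beta>"
  have "L \<beta> < L \<alpha>" using \<beta>(2) gL_pos[OF \<alpha>] by (simp add: algebra_simps)
  then have ne: "\<alpha> \<noteq> \<beta>" "\<not> below \<alpha> \<beta>" using below_L_less[of \<alpha> \<beta>] \<alpha> \<beta> by auto
  then have "below \<beta> \<alpha>"
    using overlap_nested[of \<alpha> \<beta>] \<alpha> \<beta> z cd lo_less_hi[OF \<alpha>] by auto
  then show False using gap[of \<beta>] \<beta> z cd by (auto simp: below_def)
qed

text \<open>With \<open>w0\<close> the product of the ancestors' weights at the centre, the interval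
  has mass comparable to \<open>w0 * L \<alpha>\<close>, and a small gap has mass comparable to
  \<open>w0\<close> times the integral of \<open>phi \<alpha>\<close> over it. The factor
  \<open>w0\<close> cancels in the quotient.\<close>

lemma F_ratio:
  obtains lam Lam where "0 < lam" "lam \<le> Lam"
    "\<And>\<alpha> c d. \<alpha> \<in> At \<Longrightarrow> (\<And>\<beta>. \<beta> \<in> At \<Longrightarrow> below \<beta> \<alpha> \<Longrightarrow> hi \<beta> \<le> c \<or> d \<le> lo \<beta>) \<Longrightarrow>
      lo \<alpha> \<le> c \<Longrightarrow> c < m \<alpha> \<Longrightarrow> m \<alpha> < d \<Longrightarrow> d \<le> hi \<alpha> \<Longrightarrow>
      lam * ((d - c) / L \<alpha>) powr p \<le> (F d - F c) / (F (hi \<alpha>) - F (lo \<alpha>)) \<and>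
      (F d - F c) / (F (hi \<alpha>) - F (lo \<alpha>)) \<le> Lam * ((d - c) / L \<alpha>) powr p"
proof -
  obtain C where C: "0 < C" "\<And>e x r. 0 < e \<Longrightarrow> 0 < r \<Longrightarrow> g / 8 * r \<le> e \<Longrightarrow>
    \<exists>\<kappa>>0. emeasure (N tau (big e)) {x - r..x + r} \<le> ennreal (C * \<kappa>) \<and>
      (\<forall>B\<in>sets borel. B \<subseteq> {x - r..x + r} \<longrightarrow> ennreal (g / 8 * r) \<le> emeasure lborel B \<longrightarrow>
        ennreal \<kappa> \<le> emeasure (N tau (big e)) B)"
    using N_big_comparison[of "g / 8"] g by auto
  define k1 where "k1 = exp (- K) * g / 16"
  define k2 where "k2 = C * (3 / 2 * exp K * g / 8)"
  have k: "0 < k1" "0 < k2" using g C(1) by (auto simp: k1_def k2_def)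
  define lam where "lam = exp (- K) * eta * (1 / 4) powr p / (2 * p * k2)"
  \<comment> \<open>The entries secure \<open>lam\<close> \<le> \<open>Lam\<close>, the bound for
    gaps of length at most \<open>q\<close>, and the bound for longer gaps, respectively. This local
    \<open>Lam\<close> is not the Lipschitz constant of the weights.\<close>
  define Lam where "Lam = max lam (max (3 * exp K * eta powr (1 - p) / (p * k1)) (eta powr (- p)))"
  have lam: "0 < lam" using p k eta_pos by (simp add: lam_def)
  have "lam * ((d - c) / L \<alpha>) powr p \<le> (F d - F c) / (F (hi \<alpha>) - F (lo \<alpha>)) \<and>
      (F d - F c) / (F (hi \<alpha>) - F (lo \<alpha>)) \<le> Lam * ((d - c) / L \<alpha>) powr p"
    if \<alpha>: "\<alpha> \<in> At" and gap: "\<And>\<beta>. \<beta> \<in> At \<Longrightarrow> below \<beta> \<alpha> \<Longrightarrow> hi \<beta> \<le> c \<or> d \<le> lo \<beta>"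
      and cd: "lo \<alpha> \<le> c" "c < m \<alpha>" "m \<alpha> < d" "d \<le> hi \<alpha>" for \<alpha> c d
  proof -
    define l where "l = L \<alpha>"
    define e where "e = (1 - g) * l"
    define q where "q = eta * l"
    define w where "w = W tau (anc \<alpha>)"
    define w0 where "w0 = w (m \<alpha>)"
    have l: "0 < l" using L_pos[OF \<alpha>] by (simp add: l_def)
    have e: "0 < e" using l g by (simp add: e_def)
    have gl: "0 < g * l" using l g by simp
    have "eta * l \<le> g / 64 * l" using eta_le l by (intro mult_right_mono) auto
    then have q: "0 < q" "q \<le> g * l / 64" using eta_pos l by (auto simp: q_def)
    have sat: "saturated e z" if "z \<in> {lo \<alpha>, hi \<alpha>, c, d}" for z
      unfolding e_def l_def using saturated_endpoints[OF \<alpha> gap, of z] cd that by auto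
    have ends: "lo \<alpha> + g * l \<le> m \<alpha>" "m \<alpha> + g * l \<le> hi \<alpha>" using m_ends[OF \<alpha>] by (auto simp: l_def)
    have len: "hi \<alpha> - lo \<alpha> = l" by (simp add: l_def L_def)
    have mz: "m \<alpha> \<in> zone \<alpha>" using gl by (simp add: zone_iff l_def)
    have w0: "0 < w0" unfolding w0_def w_def by (rule W_anc_pos[OF \<alpha> tau_le])
    have w_upper: "w y \<le> exp K * w0" if "y \<in> zone \<alpha>" for y
      using W_anc_oscillation[OF \<alpha> tau_le that mz] by (simp add: w_def w0_def)
    have w_lower: "exp (- K) * w0 \<le> w y" if "y \<in> zone \<alpha>" for y
      using W_anc_oscillation[OF \<alpha> tau_le mz that] by (simp add: w_def w0_def exp_minus field_simps)
    have W_eq: "W tau (big e) y = h \<alpha> (tau \<alpha>) y * w y" if "y \<in> zone \<alpha>" for y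
    proof -
      have "\<alpha> \<in> big e" using \<alpha> gl by (simp add: big_def e_def l_def algebra_simps)
      moreover have "\<not> below \<beta> \<alpha>" if "\<beta> \<in> big e" for \<beta>
        using below_L[of \<beta> \<alpha>] \<alpha> that by (auto simp: big_def e_def l_def)
      moreover have "finite (big e)" "big e \<subseteq> At" "anc \<alpha> \<subseteq> big e"
        using big_up_closed[OF e] \<open>\<alpha> \<in> big e\<close> by (auto simp: up_closed_def)
      ultimately show ?thesis
        using W_on_interval[where A = "big e" and \<alpha> = \<alpha> and y = y and t = tau] \<alpha> zone_inside[OF \<alpha> that] by (simp add: w_def)
    qed
    have W_upper: "W tau (big e) y \<le> phi \<alpha> y * (3 / 2 * (exp K * w0))" if "y \<in> zone \<alpha>" for y
    proof -
      have "0 \<le> w y" using w_lower[OF that] w0 by (smt (verit) exp_gt_zero mult_pos_pos)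
      then have "(1 + tau \<alpha> * psi \<alpha> y) * w y \<le> 3 / 2 * (exp K * w0)"
        using w_upper[OF that] bump_bounds[OF \<alpha> tau_le[of \<alpha>], of y] by (intro mult_mono) auto
      then show ?thesis
        unfolding W_eq[OF that] h_def mult.assoc using phi_nonneg[of \<alpha> y] by (rule mult_left_mono)
    qed
    have W_lower: "phi \<alpha> y * (1 / 2 * (exp (- K) * w0)) \<le> W tau (big e) y" if "y \<in> zone \<alpha>" for y
    proof -
      have "1 / 2 * (exp (- K) * w0) \<le> (1 + tau \<alpha> * psi \<alpha> y) * w y"
        using w_lower[OF that] bump_bounds[OF \<alpha> tau_le[of \<alpha>], of y] w0 by (intro mult_mono) auto
      then show ?thesis
        unfolding W_eq[OF that] h_def mult.assoc using phi_nonneg[of \<alpha> y] by (rule mult_left_mono)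
    qed
    let ?N = "N tau (big e)"
    let ?B = "{m \<alpha> + g * l / 8..m \<alpha> + g * l / 4}"
    have B: "y \<in> zone \<alpha>" "phi \<alpha> y = 1" if "y \<in> ?B" for y
    proof -
      have y: "g * l / 8 \<le> \<bar>y - m \<alpha>\<bar>" "\<bar>y - m \<alpha>\<bar> \<le> g * l / 4"
        using that gl by (auto simp: abs_if)
      show "y \<in> zone \<alpha>" using y gl by (simp add: zone_iff l_def)
      show "phi \<alpha> y = 1" using y q gl by (intro phi_eq_1[OF \<alpha>]) (simp add: q_def l_def)
    qed
    have B_lborel: "emeasure lborel ?B = ennreal (g * l / 8)" using gl by simp
    define D where "D = F (hi \<alpha>) - F (lo \<alpha>)"
    define E where "E = F d - F c"
    have D: "ennreal D = emeasure ?N {lo \<alpha><..hi \<alpha>}"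
      unfolding D_def using sat e lo_less_hi[OF \<alpha>] by (intro F_diff) auto
    have E: "ennreal E = emeasure ?N {c<..d}"
      unfolding E_def using sat e cd by (intro F_diff) auto
    have D_lower: "k1 * w0 * l \<le> D"
    proof -
      have "ennreal (k1 * w0 * l) = ennreal (1 / 2 * (exp (- K) * w0)) * ennreal (g * l / 8)"
        using gl w0 by (subst ennreal_mult[symmetric]) (auto simp: k1_def mult_ac)
      also have "\<dots> = (\<integral>\<^sup>+y. ennreal (1 / 2 * (exp (- K) * w0)) * indicator ?B y \<partial>lborel)"
        unfolding B_lborel[symmetric] by (subst nn_integral_cmult_indicator) auto
      also have "\<dots> \<le> (\<integral>\<^sup>+y. ennreal (W tau (big e) y) * indicator {lo \<alpha><..hi \<alpha>} y \<partial>lborel)"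
      proof (rule nn_integral_mono)
        fix y
        show "ennreal (1 / 2 * (exp (- K) * w0)) * indicator ?B y
            \<le> ennreal (W tau (big e) y) * indicator {lo \<alpha><..hi \<alpha>} y"
        proof (cases "y \<in> ?B")
          case True
          then show ?thesis
            using B[OF True] W_lower[of y] zone_inside[OF \<alpha>, of y] by (auto intro!: ennreal_leI)
        qed simp
      qed
      also have "\<dots> = ennreal D" unfolding D by (subst emeasure_N) auto
      finally have "ennreal (k1 * w0 * l) \<le> ennreal D" .
      moreover have "0 < k1 * w0 * l" using k w0 l by simp
      ultimately show ?thesis by (metis ennreal_le_iff2 not_less)
    qed
    have D_pos: "0 < D" using D_lower k w0 l by (smt (verit) mult_pos_pos)
    \<comment> \<open>Weights of ancestors may be singular near the ends of the interval, so its
      mass is not bounded pointwise. It is compared with the mass of \<open>?B\<close>, where the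
      density is at most \<open>3 / 2 * exp K * w0\<close>.\<close>
    have D_upper: "D \<le> k2 * w0 * l"
    proof -
      let ?x = "(lo \<alpha> + hi \<alpha>) / 2" and ?r = "l / 2"
      have xr: "?x - ?r = lo \<alpha>" "?x + ?r = hi \<alpha>" using len by (auto simp: field_simps)
      have gr: "g / 8 * ?r \<le> e" using g l by (simp add: e_def)
      obtain \<kappa> where \<kappa>: "0 < \<kappa>" "emeasure ?N {lo \<alpha>..hi \<alpha>} \<le> ennreal (C * \<kappa>)"
        "\<And>B. B \<in> sets borel \<Longrightarrow> B \<subseteq> {lo \<alpha>..hi \<alpha>} \<Longrightarrow> ennreal (g / 8 * ?r) \<le> emeasure lborel B \<Longrightarrow>
          ennreal \<kappa> \<le> emeasure ?N B"
        using C(2)[OF e _ gr, of ?x] l unfolding xr by auto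
      have "ennreal \<kappa> \<le> emeasure ?N ?B"
      proof (rule \<kappa>(3))
        show "?B \<subseteq> {lo \<alpha>..hi \<alpha>}" using ends gl by auto
        show "ennreal (g / 8 * ?r) \<le> emeasure lborel ?B"
          unfolding B_lborel using gl by (intro ennreal_leI) simp
      qed simp
      also have "\<dots> \<le> (\<integral>\<^sup>+y. ennreal (3 / 2 * (exp K * w0)) * indicator ?B y \<partial>lborel)"
        unfolding emeasure_N[of ?B, simplified]
      proof (rule nn_integral_mono)
        fix y
        show "ennreal (W tau (big e) y) * indicator ?B y \<le> ennreal (3 / 2 * (exp K * w0)) * indicator ?B y"
        proof (cases "y \<in> ?B")
          case True
          then show ?thesis using B[OF True] W_upper[of y] by (auto intro!: ennreal_leI)
        qed simp
      qed
      also have "\<dots> = ennreal (3 / 2 * (exp K * w0)) * ennreal (g * l / 8)"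
        unfolding B_lborel[symmetric] by (subst nn_integral_cmult_indicator) auto
      also have "\<dots> = ennreal (3 / 2 * (exp K * w0) * (g * l / 8))"
        using gl w0 by (intro ennreal_mult[symmetric]) auto
      finally have \<kappa>_le: "\<kappa> \<le> 3 / 2 * (exp K * w0) * (g * l / 8)"
        using gl w0 by (subst (asm) ennreal_le_iff) auto
      have "ennreal D \<le> emeasure ?N {lo \<alpha>..hi \<alpha>}" unfolding D by (intro emeasure_mono) auto
      also note \<kappa>(2)
      finally have "D \<le> C * \<kappa>" using C(1) \<kappa>(1) by (subst (asm) ennreal_le_iff) auto
      also have "\<dots> \<le> C * (3 / 2 * (exp K * w0) * (g * l / 8))" using \<kappa>_le C(1) by (intro mult_left_mono) auto
      also have "\<dots> = k2 * w0 * l" by (simp add: k2_def)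
      finally show ?thesis .
    qed
    define x where "x = (d - c) / l"
    have x: "0 < x" "x \<le> 1" using cd l len by (auto simp: x_def)
    have dc: "d - c = x * l" using l by (simp add: x_def)
    have phi_near: "phi \<alpha> y = (\<bar>y - m \<alpha>\<bar> / q) powr (p - 1)" if "\<bar>y - m \<alpha>\<bar> \<le> q" for y
    proof -
      have "\<bar>y - m \<alpha>\<bar> / q \<le> 1" using that q by simp
      then show ?thesis by (simp add: phi_def q_def l_def)
    qed
    have near_zone: "y \<in> zone \<alpha>" if "\<bar>y - m \<alpha>\<bar> \<le> q" for y
      using that q gl by (simp add: zone_iff l_def)
    have upper: "E / D \<le> Lam * x powr p"
    \<comment> \<open>Short gaps lie where \<open>phi\<close> is an exact power. For longer ones the
      quotient is at most \<open>1\<close> and \<open>x\<close> exceeds \<open>eta\<close>, so a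
      constant suffices.\<close>
    proof (cases "d - c \<le> q")
      case True
      have "ennreal E = (\<integral>\<^sup>+y. ennreal (W tau (big e) y) * indicator {c<..d} y \<partial>lborel)"
        unfolding E by (subst emeasure_N) auto
      also have "\<dots> \<le> (\<integral>\<^sup>+y. ennreal ((indicator {m \<alpha> - (d - c)..m \<alpha> + (d - c)} y *
          (\<bar>y - m \<alpha>\<bar> / q) powr (p - 1)) * (3 / 2 * (exp K * w0))) \<partial>lborel)"
      proof (rule nn_integral_mono)
        fix y
        show "ennreal (W tau (big e) y) * indicator {c<..d} y \<le> ennreal ((indicator {m \<alpha> - (d - c)..m \<alpha> + (d - c)} y *
          (\<bar>y - m \<alpha>\<bar> / q) powr (p - 1)) * (3 / 2 * (exp K * w0)))"
        proof (cases "y \<in> {c<..d}")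
          case True
          then have *: "y \<in> {m \<alpha> - (d - c)..m \<alpha> + (d - c)}" "\<bar>y - m \<alpha>\<bar> \<le> q"
            using cd \<open>d - c \<le> q\<close> by (auto simp: abs_le_iff)
          then show ?thesis
            using True W_upper[OF near_zone[OF *(2)]] phi_near[OF *(2)] by (auto intro!: ennreal_leI)
        qed simp
      qed
      also have "\<dots> = ennreal (2 * q * ((d - c) / q) powr p / p * (3 / 2 * (exp K * w0)))"
        using has_bochner_integral_mult_left[OF has_bochner_integral_powr_dist_ball[of p q "d - c" "m \<alpha>"], of "3 / 2 * (exp K * w0)"]
          p q cd w0
        by (subst nn_integral_eq_integral)
          (auto simp: has_bochner_integral_iff intro!: AE_I2 mult_nonneg_nonneg)
      finally have "E \<le> 2 * q * ((d - c) / q) powr p / p * (3 / 2 * (exp K * w0))"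
        using p q w0 by (subst (asm) ennreal_le_iff) auto
      also have "((d - c) / q) powr p = x powr p * eta powr (- p)"
        using l eta_pos x by (simp add: dc q_def powr_divide powr_minus_divide)
      also have "2 * q * (x powr p * eta powr (- p)) / p * (3 / 2 * (exp K * w0)) =
          3 * exp K * (eta * eta powr (- p)) / (p * k1) * x powr p * (k1 * w0 * l)"
        using k by (simp add: q_def)
      also have "eta * eta powr (- p) = eta powr (1 - p)"
        using eta_pos powr_add[of eta 1 "- p"] by simp
      also have "3 * exp K * eta powr (1 - p) / (p * k1) * x powr p * (k1 * w0 * l) \<le> Lam * x powr p * D"
        using D_lower k w0 l p lam by (intro mult_mono) (auto simp: Lam_def)
      finally show ?thesis using D_pos by (simp add: divide_le_eq)
    next
      case False
      have "E \<le> D" unfolding E_def D_def using cd by (intro diff_mono monoD[OF F_mono]) auto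
      then have "E / D \<le> 1" using D_pos by simp
      also have "1 \<le> (x / eta) powr p"
        using False l eta_pos p x by (intro ge_one_powr_ge_zero) (auto simp: dc q_def le_divide_eq)
      also have "\<dots> = eta powr (- p) * x powr p"
        using eta_pos x by (simp add: powr_divide powr_minus_divide)
      also have "\<dots> \<le> Lam * x powr p" by (intro mult_right_mono) (auto simp: Lam_def)
      finally show ?thesis .
    qed
    have lower: "lam * x powr p \<le> E / D"
    proof -
      define s where "s = min ((d - c) / 4) q"
      have "0 < s" using cd q by (simp add: s_def)
      moreover have "s \<le> (d - c) / 4" "s \<le> q"
        unfolding s_def by (rule min.cobounded1, rule min.cobounded2)
      ultimately have s: "0 < s" "s \<le> (d - c) / 4" "s \<le> q" by auto
      \<comment> \<open>\<open>\<sigma>\<close> points to the longer of the two parts into which the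
        centre divides the gap.\<close>
      obtain \<sigma> :: real where \<sigma>: "\<sigma> = 1 \<or> \<sigma> = - 1"
        and sub: "\<And>y. 0 \<le> \<sigma> * (y - m \<alpha>) \<Longrightarrow> \<sigma> * (y - m \<alpha>) \<le> s \<Longrightarrow> y \<in> {c<..d}"
      proof (cases "d - m \<alpha> \<ge> (d - c) / 2")
        case True
        then show ?thesis using that[of 1] s cd by auto
      next
        case False
        then show ?thesis using that[of "- 1"] s cd by auto
      qed
      let ?I = "{y. 0 \<le> \<sigma> * (y - m \<alpha>) \<and> \<sigma> * (y - m \<alpha>) \<le> s}"
      have "ennreal (q * (s / q) powr p / p * (1 / 2 * (exp (- K) * w0))) =
          (\<integral>\<^sup>+y. ennreal ((indicator ?I y * (\<bar>y - m \<alpha>\<bar> / q) powr (p - 1)) * (1 / 2 * (exp (- K) * w0))) \<partial>lborel)"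
        using has_bochner_integral_mult_left[OF has_bochner_integral_powr_dist[of p q s \<sigma> "m \<alpha>"], of "1 / 2 * (exp (- K) * w0)"]
          p q s \<sigma> w0
        by (subst nn_integral_eq_integral)
          (auto simp: has_bochner_integral_iff intro!: AE_I2 mult_nonneg_nonneg)
      also have "\<dots> \<le> (\<integral>\<^sup>+y. ennreal (W tau (big e) y) * indicator {c<..d} y \<partial>lborel)"
      proof (rule nn_integral_mono)
        fix y
        show "ennreal ((indicator ?I y * (\<bar>y - m \<alpha>\<bar> / q) powr (p - 1)) * (1 / 2 * (exp (- K) * w0)))
            \<le> ennreal (W tau (big e) y) * indicator {c<..d} y"
        proof (cases "y \<in> ?I")
          case True
          then have *: "\<bar>y - m \<alpha>\<bar> \<le> q" using \<sigma> s by auto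
          show ?thesis
            using True sub[of y] W_lower[OF near_zone[OF *]] phi_near[OF *] by (auto intro!: ennreal_leI)
        qed simp
      qed
      also have "\<dots> = ennreal E" unfolding E by (subst emeasure_N) auto
      finally have le: "ennreal (q * (s / q) powr p / p * (1 / 2 * (exp (- K) * w0))) \<le> ennreal E" .
      have "0 < q * (s / q) powr p / p * (1 / 2 * (exp (- K) * w0))"
        using q s p w0 by (intro mult_pos_pos divide_pos_pos) auto
      then have E_ge: "q * (s / q) powr p / p * (1 / 2 * (exp (- K) * w0)) \<le> E"
        using le by (metis ennreal_le_iff2 not_less)
      have "eta * (x / 4) * l \<le> x / 4 * l" "eta * (x / 4) * l \<le> eta * l"
        using eta_pos eta_le g x l by (auto intro!: mult_right_mono mult_left_le)
      then have "x / 4 * q \<le> s" by (simp add: s_def dc q_def mult_ac)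
      then have "(x / 4) powr p \<le> (s / q) powr p" using q x p by (intro powr_mono2) (auto simp: le_divide_eq)
      then have s_ge: "(1 / 4) powr p * x powr p \<le> (s / q) powr p" using x by (simp add: powr_divide)
      have "lam * x powr p * D \<le> lam * x powr p * (k2 * w0 * l)"
        using D_upper lam by (intro mult_left_mono) auto
      also have "\<dots> = q * ((1 / 4) powr p * x powr p) / p * (1 / 2 * (exp (- K) * w0))"
        using k p by (simp add: lam_def q_def field_simps)
      also have "\<dots> \<le> q * (s / q) powr p / p * (1 / 2 * (exp (- K) * w0))"
        using s_ge q p w0 by (intro mult_right_mono divide_right_mono mult_left_mono) auto
      also note E_ge
      finally show ?thesis using D_pos by (simp add: le_divide_eq)
    qed
    show ?thesis using upper lower by (simp add: E_def D_def x_def l_def)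
  qed
  moreover have "lam \<le> Lam" by (simp add: Lam_def)
  ultimately show ?thesis using that[OF lam] by blast
qed

end

section \<open>Cantor constructions as interval trees\<close>

lemma cantor_construction_ancestor:
  assumes "cantor_construction Idx a b c d" "n \<le> n'" "i \<in> Idx n'"
  shows "\<exists>j\<in>Idx n. {a n' i..b n' i} \<subseteq> {a n j..b n j}"
  using assms(2,3)
proof (induction n' arbitrary: i rule: dec_induct)
  case (step n')
  then obtain j where "j \<in> Idx n'" "{a (Suc n') i..b (Suc n') i} \<subseteq> {a n' j..b n' j}"
    using assms(1) unfolding cantor_construction_def by meson
  then show ?case using step.IH[of j] by blast
qed blast

text \<open>A later interval has an ancestor at level \<open>Suc n\<close>, where all gaps of level
  \<open>n\<close> have been removed at once.\<close>

lemma cantor_construction_gap: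
  assumes "cantor_construction Idx a b c d" "n < n'" "i \<in> Idx n'" "j \<in> Idx n"
  shows "{a n' i..b n' i} \<inter> {c n j<..<d n j} = {}"
proof -
  obtain k where k: "k \<in> Idx (Suc n)" "{a n' i..b n' i} \<subseteq> {a (Suc n) k..b (Suc n) k}"
    using cantor_construction_ancestor[OF assms(1), of "Suc n" n' i] assms by auto
  have "(\<Union>i\<in>Idx (Suc n). {a (Suc n) i..b (Suc n) i}) =
      (\<Union>i\<in>Idx n. {a n i..b n i}) - (\<Union>i\<in>Idx n. {c n i<..<d n i})"
    using assms(1) unfolding cantor_construction_def by blast
  then show ?thesis using k assms(4) by blast
qed

theorem theorem1p2:
  fixes Idx :: "nat \<Rightarrow> nat set" and a b c d :: "nat \<Rightarrow> nat \<Rightarrow> real" and p :: real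
  assumes "nice_construction Idx a b c d"
    and "0 < p"
  shows "\<exists>M :: real measure. doubling_measure M \<and>
           (\<exists>lam Lam. 0 < lam \<and> lam \<le> Lam \<and>
              (\<forall>n. \<forall>i\<in>Idx n.
                 lam * ((d n i - c n i) / (b n i - a n i)) powr p
                   \<le> measure M {c n i<..<d n i} / measure M {a n i..b n i} \<and>
                 measure M {c n i<..<d n i} / measure M {a n i..b n i}
                   \<le> Lam * ((d n i - c n i) / (b n i - a n i)) powr p))"
proof -
  obtain k where cantor: "cantor_construction Idx a b c d" and k: "0 < k" "k < 1"
    and nice: "\<And>n i. i \<in> Idx n \<Longrightarrow> {(a n i + b n i) / 2 - k * (b n i - a n i) / 2 ..
            (a n i + b n i) / 2 + k * (b n i - a n i) / 2} \<inter> {c n i<..<d n i} \<noteq> {}"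
    using assms(1) unfolding nice_construction_def by blast
  have ab: "a n i \<le> b n i" if "i \<in> Idx n" for n i
    using cantor that unfolding cantor_construction_def by (elim conjE) blast
  have disj: "{a n i<..<b n i} \<inter> {a n j<..<b n j} = {}" if "i \<in> Idx n" "j \<in> Idx n" "i \<noteq> j" for n i j
    using cantor that unfolding cantor_construction_def by (elim conjE) blast
  have cd: "{c n i<..<d n i} \<subseteq> {a n i..b n i}" if "i \<in> Idx n" for n i
    using cantor that unfolding cantor_construction_def by (elim conjE) blast
  define m where "m n i = (SOME x. x \<in> {(a n i + b n i) / 2 - k * (b n i - a n i) / 2 ..
            (a n i + b n i) / 2 + k * (b n i - a n i) / 2} \<inter> {c n i<..<d n i})" for n i
  have m_in: "m n i \<in> {(a n i + b n i) / 2 - k * (b n i - a n i) / 2 ..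
            (a n i + b n i) / 2 + k * (b n i - a n i) / 2} \<inter> {c n i<..<d n i}" if "i \<in> Idx n" for n i
    unfolding m_def using nice[OF that] by (rule some_in_eq[THEN iffD2])
  have m: "m n i \<in> {(a n i + b n i) / 2 - k * (b n i - a n i) / 2 ..
            (a n i + b n i) / 2 + k * (b n i - a n i) / 2}" if "i \<in> Idx n" for n i
    using m_in[OF that] by (rule IntD1)
  have mJ: "c n i < m n i \<and> m n i < d n i" if "i \<in> Idx n" for n i
    using m_in[OF that] by simp
  have acdb: "a n i \<le> c n i" "d n i \<le> b n i" if "i \<in> Idx n" for n i
    using cd[OF that] mJ[OF that] greaterThanLessThan_subseteq_atLeastAtMost_iff[of "c n i" "d n i" "a n i" "b n i"]
    by auto
  \<comment> \<open>Niceness makes the open gap nonempty, so a degenerate interval cannot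
    occur.\<close>
  have ab_less: "a n i < b n i" if "i \<in> Idx n" for n i
    using acdb[OF that] mJ[OF that] by auto
  obtain R where R: "\<And>x. x \<in> (\<Union>i\<in>Idx 0. {a 0 i..b 0 i}) \<Longrightarrow> \<bar>x\<bar> \<le> R"
  proof -
    have "bounded (\<Union>i\<in>Idx 0. {a 0 i..b 0 i})"
      using cantor unfolding cantor_construction_def by (elim conjE)
    then show ?thesis using that unfolding bounded_real by blast
  qed
  define At where "At = {(n, i). i \<in> Idx n}"
  \<comment> \<open>The concentric interval of relative length \<open>k\<close> leaves a margin of
    \<open>(1 - k) / 2\<close> times the length on each side, which is the depth
    \<open>g\<close>.\<close>
  interpret interval_tree At "case_prod a" "case_prod b" "case_prod m" "(1 - k) / 2" R p
  proof
    fix \<alpha> \<beta> assume "\<alpha> \<in> At" "\<beta> \<in> At" "\<alpha> \<noteq> \<beta>"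
    then obtain n i n' j where \<alpha>: "\<alpha> = (n, i)" "i \<in> Idx n" and \<beta>: "\<beta> = (n', j)" "j \<in> Idx n'"
      and ne: "(n, i) \<noteq> (n', j)" by (auto simp: At_def)
    \<comment> \<open>The ancestor of the later interval at level \<open>n\<close> is either the
      earlier interval, whose gap contains its centre and misses everything later, or another
      interval of that level with disjoint interior.\<close>
    have nested: "{a n i<..<b n i} \<inter> {a n' j<..<b n' j} = {} \<or>
        {a n' j..b n' j} \<subseteq> {a n i..b n i} \<and> m n i \<notin> {a n' j..b n' j}"
      if ij: "n < n'" "i \<in> Idx n" "j \<in> Idx n'" for n n' i j
    proof -
      obtain i' where i': "i' \<in> Idx n" "{a n' j..b n' j} \<subseteq> {a n i'..b n i'}"
        using cantor_construction_ancestor[OF cantor, of n n' j] ij by auto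
      show ?thesis
      proof (cases "i' = i")
        case True
        have "m n i \<in> {c n i<..<d n i}" using mJ ij by simp
        then show ?thesis using cantor_construction_gap[OF cantor ij(1,3,2)] i' True by blast
      next
        case False
        have "{a n' j<..<b n' j} \<subseteq> {a n i'<..<b n i'}"
          using i'(2) ab_less[OF ij(3)] by auto
        then show ?thesis using disj[OF i'(1) ij(2) False] by blast
      qed
    qed
    consider "n < n'" | "n' < n" | "n = n'" "i \<noteq> j" using ne by force
    then show "{case_prod a \<alpha><..<case_prod b \<alpha>} \<inter> {case_prod a \<beta><..<case_prod b \<beta>} = {} \<or>
      {case_prod a \<alpha>..case_prod b \<alpha>} \<subseteq> {case_prod a \<beta>..case_prod b \<beta>} \<and> case_prod m \<beta> \<notin> {case_prod a \<alpha>..case_prod b \<alpha>} \<or>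
      {case_prod a \<beta>..case_prod b \<beta>} \<subseteq> {case_prod a \<alpha>..case_prod b \<alpha>} \<and> case_prod m \<alpha> \<notin> {case_prod a \<beta>..case_prod b \<beta>}"
    proof cases
      case 1
      then show ?thesis using nested[OF 1 \<alpha>(2) \<beta>(2)] unfolding \<alpha> \<beta> prod.case by blast
    next
      case 2
      then show ?thesis using nested[OF 2 \<beta>(2) \<alpha>(2)] unfolding \<alpha> \<beta> prod.case by blast
    next
      case 3
      then show ?thesis using disj[OF \<alpha>(2), of j] \<beta> unfolding \<alpha> \<beta> prod.case by blast
    qed
  next
    fix \<alpha> assume "\<alpha> \<in> At"
    then obtain n i where \<alpha>: "\<alpha> = (n, i)" "i \<in> Idx n" by (auto simp: At_def)
    obtain i' where "i' \<in> Idx 0" "{a n i..b n i} \<subseteq> {a 0 i'..b 0 i'}"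
      using cantor_construction_ancestor[OF cantor, of 0 n i] \<alpha> by auto
    then have "\<bar>a n i\<bar> \<le> R" "\<bar>b n i\<bar> \<le> R" using ab[OF \<alpha>(2)] by (auto intro!: R)
    then show "- R \<le> case_prod a \<alpha> \<and> case_prod b \<alpha> \<le> R" by (auto simp: \<alpha>)
    show "case_prod a \<alpha> < case_prod b \<alpha>" using ab_less[OF \<alpha>(2)] by (simp add: \<alpha>)
    show "case_prod a \<alpha> + (1 - k) / 2 * (case_prod b \<alpha> - case_prod a \<alpha>) \<le> case_prod m \<alpha>"
      "case_prod m \<alpha> \<le> case_prod b \<alpha> - (1 - k) / 2 * (case_prod b \<alpha> - case_prod a \<alpha>)"
      using m[OF \<alpha>(2)] by (auto simp: \<alpha> field_simps)
  qed (use k assms in auto)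
  let ?M = "interval_measure F"
  have meas: "measure ?M {u..v} = F v - F u" "measure ?M {u<..<v} = F v - F u" if "u \<le> v" for u v
    using emeasure_interval_measure_continuous[OF F_mono F_continuous that] monoD[OF F_mono that]
    by (auto simp: measure_def)
  obtain lam Lam where lam: "0 < lam" "lam \<le> Lam"
    and ratio: "\<And>\<alpha> c d. \<alpha> \<in> At \<Longrightarrow> (\<And>\<beta>. \<beta> \<in> At \<Longrightarrow> below \<beta> \<alpha> \<Longrightarrow> case_prod b \<beta> \<le> c \<or> d \<le> case_prod a \<beta>) \<Longrightarrow>
      case_prod a \<alpha> \<le> c \<Longrightarrow> c < case_prod m \<alpha> \<Longrightarrow> case_prod m \<alpha> < d \<Longrightarrow> d \<le> case_prod b \<alpha> \<Longrightarrow>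
      lam * ((d - c) / L \<alpha>) powr p \<le> (F d - F c) / (F (case_prod b \<alpha>) - F (case_prod a \<alpha>)) \<and>
      (F d - F c) / (F (case_prod b \<alpha>) - F (case_prod a \<alpha>)) \<le> Lam * ((d - c) / L \<alpha>) powr p"
    by (rule F_ratio) blast
  have "lam * ((d n i - c n i) / (b n i - a n i)) powr p
          \<le> measure ?M {c n i<..<d n i} / measure ?M {a n i..b n i} \<and>
        measure ?M {c n i<..<d n i} / measure ?M {a n i..b n i}
          \<le> Lam * ((d n i - c n i) / (b n i - a n i)) powr p" if i: "i \<in> Idx n" for n i
  proof -
    have \<alpha>: "(n, i) \<in> At" using i by (simp add: At_def)
    have gap: "case_prod b \<beta> \<le> c n i \<or> d n i \<le> case_prod a \<beta>" if \<beta>: "\<beta> \<in> At" "below \<beta> (n, i)" for \<beta>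
    proof -
      obtain n' j where nj: "\<beta> = (n', j)" "j \<in> Idx n'" using \<beta> by (auto simp: At_def)
      have sub: "{a n' j..b n' j} \<subseteq> {a n i..b n i}" "n \<noteq> n' \<or> i \<noteq> j"
        using \<beta>(2) by (auto simp: below_def nj)
      \<comment> \<open>An inclusion cannot run against the levels: if \<open>n' < n\<close>, the
        centre of the smaller interval lies in a gap already removed from the larger one. Equal
        levels contradict disjoint interiors.\<close>
      have "n < n'"
      proof (rule ccontr)
        assume "\<not> n < n'"
        then consider "n' < n" | "n' = n" "i \<noteq> j" using sub by force
        then show False
        proof cases
          case 1
          have "m n' j \<in> {c n' j<..<d n' j}" "m n' j \<in> {a n' j..b n' j}" using mJ[OF nj(2)] acdb[OF nj(2)] by auto
          then show False using cantor_construction_gap[OF cantor 1 i nj(2)] sub by blast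
        next
          case 2
          have "{a n j<..<b n j} \<subseteq> {a n i<..<b n i}" using sub(1) ab_less[OF nj(2)] 2 by auto
          moreover have "(a n j + b n j) / 2 \<in> {a n j<..<b n j}" using ab_less[OF nj(2)] 2 by auto
          ultimately show False using disj[OF i, of j] nj 2 by blast
        qed
      qed
      then have "{a n' j..b n' j} \<inter> {c n i<..<d n i} = {}"
        using cantor_construction_gap[OF cantor] nj i by blast
      \<comment> \<open>If the interval were on neither side of the gap, this midpoint of the
        overlap would lie in both.\<close>
      moreover have "(max (a n' j) (c n i) + min (b n' j) (d n i)) / 2 \<in> {a n' j..b n' j} \<inter> {c n i<..<d n i}"
        if "c n i < b n' j" "a n' j < d n i"
        using that ab_less[OF nj(2)] mJ[OF i] by (auto simp: max_def min_def)
      ultimately show ?thesis by (force simp: nj)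
    qed
    show ?thesis
      using ratio[OF \<alpha> gap] acdb[OF i] mJ[OF i] ab[OF i] by (simp add: meas L_def)
  qed
  then show ?thesis
    using doubling_interval_measure_F lam by blast
qed

end
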